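(* Let $n\ge 1$ and let $\mathrm{Up}(2n)$ be the set of all $(m,k)\in[2,2n]\times[1,2n-1]$ such that either $m-1\le k$, or $(m,k)=(3,1)$, or $(m,k)=(2n,2n-2)$. Then for every $(m,k)\in\mathrm{Up}(2n)$, $$f_{2n}(2n+1-k,\,2n+1-m)=f_{2n}(m,k).$$
   Context: An increasing tree of size $N$ is a planar binary tree with $N$ nodes labeled bijectively by $1,\dots,N$, the root labeled $1$, each node having $0$, $1$ or $2$ children, each child designated as a left child or a right child (at most one of each), and each node's label smaller than its children's labels. Its rightmost node is the node reached from the root by repeatedly moving to the right child until a node without right child is reached. The tree is complete if every node is either a leaf or has two children, except that when $N$ is even the rightmost node has exactly one child, which is a left child. Let $\mathfrak T_N$ be the set of complete increasing trees of size $N$. For $t\in\mathfrak T_N$: for a node $a$ with children, let $\min a$ be the smallest label of its children; the minimal chain is $a_1=1, a_2=\min a_1,\dots$, continued until a leaf $a_j$ is reached, and $\mathrm{eoc}(t):=a_j$. The node labeled $N$ is a leaf; $\mathrm{pom}(t)$ is the label of its parent. Set $f_{2n}(m,k):=\#\{t\in\mathfrak T_{2n}:\mathrm{eoc}(t)=m,\ \mathrm{pom}(t)=k\}$, with $f_{2n}(m,k)=0$ if $(m,k)\notin[2,2n]\times[1,2n-1]$. *)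

theory Defs
  imports "HOL-Library.Tree"
begin

text \<open>
  Planar binary trees are modelled by \<^typ>\<open>nat tree\<close>: \<^const>\<open>Node\<close> is a node carrying
  its label, and \<^const>\<open>Leaf\<close> stands for an absent child. A leaf in the combinatorial
  sense is therefore a node both of whose subtrees are \<^const>\<open>Leaf\<close>.
\<close>

fun root_labels :: "nat tree \<Rightarrow> nat set" where
  "root_labels \<langle>\<rangle> = {}"
| "root_labels \<langle>l, a, r\<rangle> = {a}"

text \<open>Nodes are identified with their labels, which is legitimate when labels are distinct.\<close>

definition children :: "nat tree \<Rightarrow> nat \<Rightarrow> nat set" where
  "children t a = (\<Union>{root_labels l \<union> root_labels r | l r. \<langle>l, a, r\<rangle> \<in> subtrees t})"

text \<open>
  Since \<^term>\<open>size t\<close> is the number of nodes, the equation for \<^term>\<open>set_tree t\<close>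
  says that the labelling is a bijection onto \<open>{1..N}\<close>.
\<close>

definition increasing_tree :: "nat \<Rightarrow> nat tree \<Rightarrow> bool" where
  "increasing_tree N t \<longleftrightarrow>
     size t = N \<and> set_tree t = {1..N} \<and> root_labels t = {1} \<and>
     (\<forall>a\<in>set_tree t. \<forall>b\<in>children t a. a < b)"

fun rightmost :: "nat tree \<Rightarrow> nat" where
  "rightmost \<langle>\<rangle> = undefined"
| "rightmost \<langle>l, a, r\<rangle> = (if r = \<langle>\<rangle> then a else rightmost r)"

text \<open>
  This is unrelated to the library's \<^const>\<open>complete\<close>, which denotes perfectly balanced trees.
\<close>

definition complete_increasing_trees :: "nat \<Rightarrow> nat tree set" where
  "complete_increasing_trees N =
     {t. increasing_tree N t \<and>
         (\<forall>l a r. \<langle>l, a, r\<rangle> \<in> subtrees t \<longrightarrow>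
            (if even N \<and> a = rightmost t
             then l \<noteq> \<langle>\<rangle> \<and> r = \<langle>\<rangle>
             else l = \<langle>\<rangle> \<and> r = \<langle>\<rangle> \<or> l \<noteq> \<langle>\<rangle> \<and> r \<noteq> \<langle>\<rangle>))}"

definition min_child :: "nat tree \<Rightarrow> nat \<Rightarrow> nat" where
  "min_child t a = Min (children t a)"

text \<open>\<open>min_chain t j\<close> is the entry $a_{j+1}$ of the minimal chain, meaningful up to its first leaf.\<close>

definition min_chain :: "nat tree \<Rightarrow> nat \<Rightarrow> nat" where
  "min_chain t j = (min_child t ^^ j) 1"

definition eoc :: "nat tree \<Rightarrow> nat" where
  "eoc t = min_chain t (LEAST j. children t (min_chain t j) = {})"

definition pom :: "nat tree \<Rightarrow> nat" where
  "pom t = (THE k. size t \<in> children t k)"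

text \<open>\<open>f2 n m k\<close> is $f_{2n}(m,k)$: the first argument is half the size of the trees.\<close>

definition f2 :: "nat \<Rightarrow> nat \<Rightarrow> nat \<Rightarrow> nat" where
  "f2 n m k =
     (if (m, k) \<in> {2..2*n} \<times> {1..2*n-1}
      then card {t \<in> complete_increasing_trees (2*n). eoc t = m \<and> pom t = k}
      else 0)"

definition Up :: "nat \<Rightarrow> (nat \<times> nat) set" where
  "Up n = {(m, k) \<in> {2..2*n} \<times> {1..2*n-1}.
     m - 1 \<le> k \<or> (m, k) = (3, 1) \<or> (m, k) = (2*n, 2*n-2)}"

end

(*
Complete increasing trees of size 2n are grown label by label. A partial tree with s ordinary open
slots also has a special slot at the end of its rightmost branch, and the next label either becomes
a leaf in an ordinary slot (s decreases) or an internal node in any slot (s increases). Trees thus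
become words, and adding one letter acts on functions of s as an operator L which is self-adjoint
because a step up from s and a step down from s + 1 both allow s + 1 slots.

Before its end the minimal chain keeps two adjacent slots marked: it continues in the first of them
to be filled, and ends if that happens by a leaf. Weighting the state "special slot marked" by 1 and
the state "two ordinary slots marked" by s - 1 gives a combination that again evolves by L. Hence
for m < k, with D the multiplication by 2u + 1 and delta the indicator of 0,
  f(m, k) = (L^(m-2) D L^(k-m-1) D L^(2n-k-1) delta)(0),
which self-adjointness makes symmetric. The case m = k + 1 and the corners are treated in the same way.
*)
theory Submission
  imports Defs "HOL-Library.Multiset"
begin

section \<open>Counting words\<close>

text \<open>The two factors 2u + 1 have unrelated origins, and their agreement is what makes the
  product for m < k a palindrome. The parent of the largest label can be put into one of u ordinary
  slots, each opening two places for that label, or into the special slot, which opens only one. The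
  chain, on s = u + 1 ordinary slots, can end in one place if the special slot is marked and in two
  otherwise, which the weights 1 and u turn into 1 + 2u. If m < k, the chain is over before the
  parent is placed, so the number of open slots is all that has to be remembered in between. If m =
  k + 1, the two choices are adjacent and interfere; together they give the single factor (2u + 1)^2
  + 1. Its value is irrelevant for the symmetry, because any diagonal factor between two powers of L
  can be read from both sides. The case m = k is void, since m is a leaf and k is not.\<close>

text \<open>
  The letter \<open>(i, b)\<close> puts the next label into slot \<open>i\<close>, as an internal node if \<open>b\<close> and as a leaf otherwise.
  The \<open>s\<close> ordinary slots are numbered from left to right, starting with 0; the special slot is number \<open>s\<close>.
  It never receives a leaf and stays empty in the end.
\<close>

fun valid :: "nat \<Rightarrow> (nat \<times> bool) list \<Rightarrow> bool" where
  "valid s [] \<longleftrightarrow> s = 0"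
| "valid s ((i, b) # w) \<longleftrightarrow> (if b then i \<le> s \<and> valid (Suc s) w else i < s \<and> valid (s - 1) w)"

text \<open>The number of the slot \<open>p \<noteq> i\<close> after the letter \<open>(i, b)\<close>.\<close>

definition shift :: "nat \<Rightarrow> bool \<Rightarrow> nat \<Rightarrow> nat" where
  "shift i b p = (if p < i then p else if b then Suc p else p - 1)"

fun filled_last :: "nat \<Rightarrow> (nat \<times> bool) list \<Rightarrow> bool" where
  "filled_last p [] \<longleftrightarrow> False"
| "filled_last p ((i, b) # w) \<longleftrightarrow> (if w = [] then i = p else i \<noteq> p \<and> filled_last (shift i b p) w)"

text \<open>The last letter fills a slot opened by the letter at position \<open>d\<close> (counted from 0).\<close>

fun parent_last :: "nat \<Rightarrow> (nat \<times> bool) list \<Rightarrow> bool" where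
  "parent_last d [] \<longleftrightarrow> False"
| "parent_last 0 ((i, b) # w) \<longleftrightarrow> b \<and> (filled_last i w \<or> filled_last (Suc i) w)"
| "parent_last (Suc d) (x # w) \<longleftrightarrow> parent_last d w"

text \<open>
  The minimal chain with marked slots \<open>p\<close> and \<open>p + 1\<close> ends with the letter at position \<open>e\<close>. The special
  slot is marked iff \<open>p + 1 = s\<close>.
\<close>

fun chain_ends :: "nat \<Rightarrow> nat \<Rightarrow> (nat \<times> bool) list \<Rightarrow> bool" where
  "chain_ends e p [] \<longleftrightarrow> False"
| "chain_ends 0 p ((i, b) # w) \<longleftrightarrow> \<not> b \<and> (i = p \<or> i = Suc p)"
| "chain_ends (Suc e) p ((i, b) # w) \<longleftrightarrow>
     (if i = p \<or> i = Suc p then b \<and> chain_ends e i w else chain_ends e (shift i b p) w)"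

definition count :: "((nat \<times> bool) list \<Rightarrow> bool) \<Rightarrow> nat \<Rightarrow> nat \<Rightarrow> nat" where
  "count P r s = card {w. length w = r \<and> valid s w \<and> P w}"

lemma count_cong:
  "(\<And>w. length w = r \<Longrightarrow> valid s w \<Longrightarrow> P w \<longleftrightarrow> Q w) \<Longrightarrow> count P r s = count Q r s"
  unfolding count_def by (rule arg_cong[where f = card]) blast

lemma words_Suc:
  "{w. length w = Suc r \<and> valid s w \<and> P w} =
     (\<lambda>(i, w). (i, True) # w) ` (SIGMA i:{..s}. {w. length w = r \<and> valid (Suc s) w \<and> P ((i, True) # w)}) \<union>
     (\<lambda>(i, w). (i, False) # w) ` (SIGMA i:{..<s}. {w. length w = r \<and> valid (s - 1) w \<and> P ((i, False) # w)})"
  (is "?L = ?A \<union> ?B")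
proof
  show "?L \<subseteq> ?A \<union> ?B"
  proof
    fix w assume w: "w \<in> ?L"
    then obtain i b v where "w = (i, b) # v"
      by (cases w) auto
    with w show "w \<in> ?A \<union> ?B"
      by (cases b) (auto simp: image_iff)
  qed
qed auto

lemma finite_words: "finite {w. length w = r \<and> valid s w \<and> P w}"
proof (induction r arbitrary: s P)
  case (Suc r)
  show ?case
    unfolding words_Suc by (intro finite_UnI finite_imageI finite_SigmaI Suc) auto
qed simp

lemma count_Suc:
  "count P (Suc r) s =
     (\<Sum>i\<le>s. count (\<lambda>w. P ((i, True) # w)) r (Suc s)) +
     (\<Sum>i<s. count (\<lambda>w. P ((i, False) # w)) r (s - 1))"
proof -
  have inj: "inj_on (\<lambda>(i :: nat, w). (i, b) # w) A" for b :: bool and A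
    by (auto simp: inj_on_def)
  show ?thesis
    unfolding count_def words_Suc
    apply (subst card_Un_disjoint)
       apply (intro finite_imageI finite_SigmaI finite_words finite_atMost)
      apply (intro finite_imageI finite_SigmaI finite_words finite_lessThan)
     apply auto[1]
    apply (simp add: card_image[OF inj] card_SigmaI finite_words)
    done
qed

lemma count_SucI:
  assumes "\<And>i. i \<le> s \<Longrightarrow> count (\<lambda>w. P ((i, True) # w)) r (Suc s) = f i"
    and "\<And>i. i < s \<Longrightarrow> count (\<lambda>w. P ((i, False) # w)) r (s - 1) = g i"
  shows "count P (Suc r) s = (\<Sum>i\<le>s. f i) + (\<Sum>i<s. g i)"
  by (subst count_Suc) (use assms in simp)

lemma count_False [simp]: "count (\<lambda>w. False) r s = 0"
  by (simp add: count_def)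

lemma count_disjoint:
  assumes "\<And>w. length w = r \<Longrightarrow> valid s w \<Longrightarrow> \<not> (P w \<and> Q w)"
  shows "count (\<lambda>w. P w \<or> Q w) r s = count P r s + count Q r s"
proof -
  have "{w. length w = r \<and> valid s w \<and> (P w \<or> Q w)} =
     {w. length w = r \<and> valid s w \<and> P w} \<union> {w. length w = r \<and> valid s w \<and> Q w}"
    by auto
  then show ?thesis
    unfolding count_def using assms
    by (simp add: card_Un_disjoint finite_words disjoint_iff)
qed

text \<open>The operator $L$ of the introduction; \<open>completions r u\<close> is the number of valid words of length \<open>r\<close> on \<open>u\<close> slots.\<close>

definition step_op :: "(nat \<Rightarrow> nat) \<Rightarrow> nat \<Rightarrow> nat" where
  "step_op g u = Suc u * g (Suc u) + u * g (u - 1)"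

definition completions :: "nat \<Rightarrow> nat \<Rightarrow> nat" where
  "completions r = (step_op ^^ r) (\<lambda>u. if u = 0 then 1 else 0)"

lemma completions_0: "completions 0 u = (if u = 0 then 1 else 0)"
  by (simp add: completions_def)

lemma completions_Suc: "completions (Suc r) u = Suc u * completions r (Suc u) + u * completions r (u - 1)"
  by (simp add: completions_def step_op_def)

section \<open>Counting words by the slot and by the parent of the last label\<close>

lemma sum_except_const: "finite A \<Longrightarrow> (\<Sum>i\<in>A. if i = p then 0 else c) = card (A - {p}) * (c :: nat)"
  by (simp add: sum.If_cases Diff_eq)

text \<open>Slot \<open>p\<close> is reserved for the last letter. The other \<open>s - 1\<close>
  ordinary slots and the special one admit \<open>s\<close> internal letters and
  \<open>s - 1\<close> leaves, which is the rule of \<open>step_op\<close> at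
  \<open>u = s - 1\<close>.\<close>

lemma count_filled_last:
  "p < s \<Longrightarrow> count (filled_last p) (Suc r) s = completions r (s - 1)"
proof (induction r arbitrary: s p)
  case 0
  have "{w. length w = Suc 0 \<and> valid s w \<and> filled_last p w} = (if s = 1 then {[(p, False)]} else {})"
    using 0 by (auto simp: length_Suc_conv split: if_splits)
  then show ?case
    using 0 by (simp add: count_def completions_0)
next
  case (Suc r)
  have nn: "w \<noteq> []" if "length w = Suc r" for w :: "(nat \<times> bool) list" using that by auto
  have u: "count (\<lambda>w. filled_last p ((i, True) # w)) (Suc r) (Suc s) = (if i = p then 0 else completions r s)"
    if "i \<le> s" for i
  proof (cases "i = p")
    case False
    then have "count (\<lambda>w. filled_last p ((i, True) # w)) (Suc r) (Suc s) =
        count (filled_last (shift i True p)) (Suc r) (Suc s)"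
      by (intro count_cong) (use nn in auto)
    then show ?thesis using False Suc.IH[of "shift i True p" "Suc s"] Suc.prems
      by (simp add: shift_def)
  next
    case True
    then have "count (\<lambda>w. filled_last p ((i, True) # w)) (Suc r) (Suc s) =
        count (\<lambda>w. False) (Suc r) (Suc s)"
      by (intro count_cong) (use nn in auto)
    then show ?thesis using True by simp
  qed
  have d: "count (\<lambda>w. filled_last p ((i, False) # w)) (Suc r) (s - 1) = (if i = p then 0 else completions r (s - 2))"
    if "i < s" for i
  proof (cases "i = p")
    case False
    then have "count (\<lambda>w. filled_last p ((i, False) # w)) (Suc r) (s - 1) =
        count (filled_last (shift i False p)) (Suc r) (s - 1)"
      by (intro count_cong) (use nn in auto)
    moreover have "shift i False p < s - 1" 
      using False that Suc.prems by (auto simp: shift_def)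
    ultimately show ?thesis using False Suc.IH[of "shift i False p" "s - 1"]
      by (simp add: numeral_2_eq_2)
  next
    case True
    then have "count (\<lambda>w. filled_last p ((i, False) # w)) (Suc r) (s - 1) =
        count (\<lambda>w. False) (Suc r) (s - 1)"
      by (intro count_cong) (use nn in auto)
    then show ?thesis using True by simp
  qed
  have "count (filled_last p) (Suc (Suc r)) s =
     (\<Sum>i\<le>s. if i = p then 0 else completions r s) + (\<Sum>i<s. if i = p then 0 else completions r (s - 2))"
    by (rule count_SucI[OF u d])
  also have "\<dots> = card ({..s} - {p}) * completions r s + card ({..<s} - {p}) * completions r (s - 2)"
    by (simp add: sum_except_const)
  also have "\<dots> = s * completions r s + (s - 1) * completions r (s - 2)"
    using Suc.prems by simp
  also have "\<dots> = completions (Suc r) (s - 1)"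
    using Suc.prems by (simp add: completions_Suc numeral_2_eq_2)
  finally show ?case .
qed

text \<open>The last letter of a valid word is a leaf, and \<open>shift\<close> sends the special
  slot to the special slot as long as it is not hit.\<close>

lemma filled_last_special: "valid s w \<Longrightarrow> \<not> filled_last s w"
proof (induction s w rule: valid.induct)
  case (2 s i b w)
  then show ?case by (cases b) (auto simp: shift_def)
qed simp

lemma filled_last_unique:
  "valid s w \<Longrightarrow> filled_last p w \<Longrightarrow> filled_last q w \<Longrightarrow> p = q"
proof (induction w arbitrary: s p q)
  case (Cons x w)
  obtain i b where x: "x = (i, b)" by force
  show ?case
  proof (cases "w = []")
    case False
    with Cons.prems x have ne: "i \<noteq> p" "i \<noteq> q" and "filled_last (shift i b p) w" "filled_last (shift i b q) w"
      "\<exists>s. valid s w" by (auto split: if_splits)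
    with Cons.IH have "shift i b p = shift i b q" by blast
    with ne show ?thesis by (auto simp: shift_def split: if_splits)
  qed (use Cons.prems x in auto)
qed simp

text \<open>An internal letter in an ordinary slot opens two ordinary slots, either of which may be
  reserved for the last letter. In the special slot it opens one ordinary slot and the new special
  slot, which is no candidate. Hence the factor \<open>2 * s + 1\<close>.\<close>

lemma count_parent_last_0:
  "count (parent_last 0) (Suc (Suc r)) s = (2 * s + 1) * completions r s"
proof -
  have u: "count (\<lambda>w. parent_last 0 ((i, True) # w)) (Suc r) (Suc s) = (if i = s then 1 else 2) * completions r s"
    if "i \<le> s" for i
  proof -
    have "count (\<lambda>w. parent_last 0 ((i, True) # w)) (Suc r) (Suc s) =
      count (filled_last i) (Suc r) (Suc s) + count (filled_last (Suc i)) (Suc r) (Suc s)"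
      by simp (rule count_disjoint, metis filled_last_unique n_not_Suc_n)
    moreover have "count (filled_last (Suc s)) (Suc r) (Suc s) = count (\<lambda>w. False) (Suc r) (Suc s)"
      by (intro count_cong) (auto dest: filled_last_special)
    ultimately show ?thesis
      using that by (auto simp: count_filled_last)
  qed
  have "count (parent_last 0) (Suc (Suc r)) s = (\<Sum>i\<le>s. (if i = s then 1 else 2) * completions r s) + (\<Sum>i<s. 0)"
    by (rule count_SucI[OF u]) simp_all
  also have "\<dots> = (\<Sum>i<s. 2 * completions r s) + completions r s"
    by (simp add: lessThan_Suc_atMost[symmetric])
  finally show ?thesis by simp
qed

text \<open>The length is made up of \<open>d\<close> unrestricted letters, the parent,
  \<open>r\<close> letters that avoid the reserved slot, and the last letter.\<close>

lemma count_parent_last: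
  "count (parent_last d) (Suc (Suc (d + r))) s = (step_op ^^ d) (\<lambda>u. (2 * u + 1) * completions r u) s"
proof (induction d arbitrary: s)
  case 0
  show ?case using count_parent_last_0 by simp
next
  case (Suc d)
  show ?case
    by (subst count_Suc) (simp add: Suc del: mult_Suc, simp add: step_op_def)
qed

section \<open>Letters before both the chain end and the parent of the last label\<close>

definition joint :: "nat \<Rightarrow> nat \<Rightarrow> nat \<Rightarrow> nat \<Rightarrow> nat \<Rightarrow> nat" where
  "joint e d r s p = count (\<lambda>w. chain_ends e p w \<and> parent_last d w) r s"

text \<open>The special slot is marked. An internal letter in slot \<open>p\<close> moves the marks
  to two ordinary slots; in any other slot it leaves the special slot marked, if it lies in the
  special slot itself because the special slot is reopened at its right. A leaf must avoid slot
  \<open>p\<close>, where it would end the chain too early.\<close>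

lemma joint_Suc_last:
  assumes J: "\<And>s p. p < s \<Longrightarrow> joint e d r s p = (if Suc p = s then X s else Y s)"
  shows "joint (Suc e) (Suc d) (Suc r) (Suc p) p =
     Suc p * X (Suc (Suc p)) + Y (Suc (Suc p)) + p * X p"
proof -
  have u: "count (\<lambda>w. chain_ends (Suc e) p ((i, True) # w) \<and> parent_last (Suc d) ((i, True) # w)) r (Suc (Suc p))
      = (if i = p then Y (Suc (Suc p)) else X (Suc (Suc p)))" if "i \<le> Suc p" for i
    using that J[of "Suc p" "Suc (Suc p)"] J[of p "Suc (Suc p)"]
    by (cases "i < p"; cases "i = p") (auto simp: joint_def shift_def le_Suc_eq)
  have d: "count (\<lambda>w. chain_ends (Suc e) p ((i, False) # w) \<and> parent_last (Suc d) ((i, False) # w)) r p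
      = (if i = p then 0 else X p)" if "i < Suc p" for i
    using that J[of "p - 1" p]
    by (cases "i = p") (auto simp: joint_def shift_def less_Suc_eq)
  have "joint (Suc e) (Suc d) (Suc r) (Suc p) p =
     (\<Sum>i\<le>Suc p. if i = p then Y (Suc (Suc p)) else X (Suc (Suc p))) + (\<Sum>i<Suc p. if i = p then 0 else X p)"
    unfolding joint_def by (rule count_SucI) (simp_all only: u d diff_Suc_1)
  also have "\<dots> = Suc p * X (Suc (Suc p)) + Y (Suc (Suc p)) + p * X p"
    by (simp add: lessThan_Suc_atMost[symmetric])
  finally show ?thesis .
qed

text \<open>Once both marked slots are ordinary they stay so: a marked slot filled by an internal
  node is replaced by its two new slots, which are ordinary again. A leaf must avoid the two marked
  slots.\<close>

lemma joint_Suc_inner: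
  assumes J: "\<And>s p. p < s \<Longrightarrow> joint e d r s p = (if Suc p = s then X s else Y s)"
    and p: "Suc p < s"
  shows "joint (Suc e) (Suc d) (Suc r) s p = Suc s * Y (Suc s) + (s - 2) * Y (s - 1)"
proof -
  have u: "count (\<lambda>w. chain_ends (Suc e) p ((i, True) # w) \<and> parent_last (Suc d) ((i, True) # w)) r (Suc s)
      = Y (Suc s)" if "i \<le> s" for i
    using that p J[of "Suc p" "Suc s"] J[of p "Suc s"]
    by (cases "i < p"; cases "i = p"; cases "i = Suc p") (auto simp: joint_def shift_def)
  have d: "count (\<lambda>w. chain_ends (Suc e) p ((i, False) # w) \<and> parent_last (Suc d) ((i, False) # w)) r (s - 1)
      = (if i \<in> {p, Suc p} then 0 else Y (s - 1))" if "i < s" for i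
  proof -
    consider "i < p" | "i = p \<or> i = Suc p" | "i > Suc p" by linarith
    then show ?thesis
    proof cases
      case 1
      then show ?thesis using p J[of "p - 1" "s - 1"] by (auto simp: joint_def shift_def)
    next
      case 2
      then show ?thesis by auto
    next
      case 3
      then have "p < s - 1" "Suc p \<noteq> s - 1" using that by auto
      with 3 show ?thesis using J[of "p" "s - 1"] by (auto simp: joint_def shift_def)
    qed
  qed
  have "(\<Sum>i<s. if i \<in> {p, Suc p} then 0 else Y (s - 1)) = (s - 2) * Y (s - 1)"
  proof -
    have "{..<s} \<inter> {i. i \<notin> {p, Suc p}} = {..<s} - {p, Suc p}" by auto
    moreover have "card ({..<s} - {p, Suc p}) = s - 2" using p by (subst card_Diff_subset) auto
    ultimately show ?thesis by (subst sum.If_cases) (auto simp: Compl_eq)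
  qed
  then show ?thesis
    unfolding joint_def
    by (subst count_SucI[where f = "\<lambda>i. Y (Suc s)", OF u d]) simp_all
qed

text \<open>
  The values \<open>X\<close> (special slot marked) and \<open>Y\<close> (two ordinary slots marked) satisfy a coupled recursion,
  but the combination \<open>X (u + 1) + u * Y (u + 1)\<close> evolves by \<^const>\<open>step_op\<close> alone.
\<close>

lemma joint_iterate:
  assumes base: "\<And>s p. p < s \<Longrightarrow> joint e d r s p = (if Suc p = s then X s else Y s)"
  shows "\<exists>X' Y'. (\<forall>s p. p < s \<longrightarrow> joint (e + c) (d + c) (r + c) s p = (if Suc p = s then X' s else Y' s)) \<and>
    (\<forall>u. X' (Suc u) + u * Y' (Suc u) = (step_op ^^ c) (\<lambda>u. X (Suc u) + u * Y (Suc u)) u)"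
proof (induction c)
  case 0
  show ?case
    by (intro exI[of _ X] exI[of _ Y]) (simp add: base)
next
  case (Suc c)
  then obtain X1 Y1 where
    J: "\<And>s p. p < s \<Longrightarrow> joint (e + c) (d + c) (r + c) s p = (if Suc p = s then X1 s else Y1 s)"
    and Z: "\<And>u. X1 (Suc u) + u * Y1 (Suc u) = (step_op ^^ c) (\<lambda>u. X (Suc u) + u * Y (Suc u)) u"
    by blast
  let ?X = "\<lambda>s. s * X1 (Suc s) + Y1 (Suc s) + (s - 1) * X1 (s - 1)"
  let ?Y = "\<lambda>s. Suc s * Y1 (Suc s) + (s - 2) * Y1 (s - 1)"
  have "joint (e + Suc c) (d + Suc c) (r + Suc c) s p = (if Suc p = s then ?X s else ?Y s)"
    if "p < s" for s p
    using that joint_Suc_last[OF J, of p] joint_Suc_inner[OF J, of p s] by auto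
  \<comment> \<open>The weight \<open>u\<close> works because of 1 + u(u + 2) = (u + 1)^2: the
    coefficients of \<open>Y1 (u + 2)\<close> from the two recursions add up to a square, one factor
    being that of \<open>step_op\<close> and the other the weight at \<open>u + 1\<close>.\<close>
  moreover have "?X (Suc u) + u * ?Y (Suc u) = (step_op ^^ Suc c) (\<lambda>u. X (Suc u) + u * Y (Suc u)) u" for u
    by (cases u) (simp_all add: step_op_def Z[symmetric] algebra_simps)
  ultimately show ?case
    by (intro exI[of _ ?X] exI[of _ ?Y]) simp
qed

text \<open>After label 1 there is one ordinary slot, so \<open>u = 0\<close>; the weight of
  \<open>Y'\<close> vanishes and the combination is the count itself.\<close>

lemma joint_start:
  assumes base: "\<And>s p. p < s \<Longrightarrow> joint e d r s p = (if Suc p = s then X s else Y s)"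
    and g: "\<And>u. X (Suc u) + u * Y (Suc u) = g u"
  shows "joint (e + c) (d + c) (r + c) 1 0 = (step_op ^^ c) g 0"
proof -
  obtain X' Y' where "\<forall>s p. p < s \<longrightarrow> joint (e + c) (d + c) (r + c) s p = (if Suc p = s then X' s else Y' s)"
    and "\<forall>u. X' (Suc u) + u * Y' (Suc u) = (step_op ^^ c) g u"
    using joint_iterate[OF base, of c] unfolding g by blast
  from this(1)[rule_format, of 0 1] this(2)[rule_format, of 0] show ?thesis by simp
qed

section \<open>Self-adjointness and symmetry\<close>

lemma sum_indicator_const:
  "finite A \<Longrightarrow> (\<Sum>i\<in>A. if i \<in> B then c else 0) = card (A \<inter> B) * (c :: nat)"
  by (simp add: sum.If_cases)

text \<open>As a matrix, \<open>step_op\<close> is tridiagonal with the entry \<open>Suc u\<close>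
  at both (u, u + 1) and (u + 1, u). The vanishing of \<open>f\<close> from \<open>K\<close> on
  removes the boundary terms, so \<open>g\<close> can be arbitrary.\<close>

lemma step_op_adjoint:
  assumes "\<And>u. u \<ge> K \<Longrightarrow> f u = 0"
  shows "(\<Sum>u\<le>K. step_op f u * g u) = (\<Sum>u\<le>K. f u * step_op g u)"
proof -
  have "(\<Sum>u\<le>K. u * f (u - 1) * g u) = (\<Sum>u<K. Suc u * f u * g (Suc u))"
    by (subst lessThan_Suc_atMost[symmetric], subst sum.lessThan_Suc_shift) simp
  also have "\<dots> = (\<Sum>u\<le>K. Suc u * f u * g (Suc u))"
    using assms[of K] by (simp flip: lessThan_Suc_atMost)
  finally have 1: "(\<Sum>u\<le>K. u * f (u - 1) * g u) = (\<Sum>u\<le>K. Suc u * f u * g (Suc u))" .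
  have "(\<Sum>u\<le>K. u * f u * g (u - 1)) = (\<Sum>u<K. Suc u * f (Suc u) * g u)"
    by (subst lessThan_Suc_atMost[symmetric], subst sum.lessThan_Suc_shift) simp
  also have "\<dots> = (\<Sum>u\<le>K. Suc u * f (Suc u) * g u)"
    using assms[of "Suc K"] by (simp flip: lessThan_Suc_atMost)
  finally have 2: "(\<Sum>u\<le>K. u * f u * g (u - 1)) = (\<Sum>u\<le>K. Suc u * f (Suc u) * g u)" .
  have "(\<Sum>u\<le>K. step_op f u * g u) = (\<Sum>u\<le>K. Suc u * f (Suc u) * g u) + (\<Sum>u\<le>K. u * f (u - 1) * g u)"
    by (simp only: step_op_def add_mult_distrib sum.distrib)
  also have "\<dots> = (\<Sum>u\<le>K. u * f u * g (u - 1)) + (\<Sum>u\<le>K. Suc u * f u * g (Suc u))"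
    by (simp only: 1 2)
  also have "\<dots> = (\<Sum>u\<le>K. f u * step_op g u)"
    unfolding sum.distrib[symmetric] by (rule sum.cong) (simp_all add: step_op_def algebra_simps)
  finally show ?thesis .
qed

lemma step_op_support:
  "(\<And>u. u \<ge> a \<Longrightarrow> f u = 0) \<Longrightarrow> u \<ge> a + c \<Longrightarrow> (step_op ^^ c) f u = 0"
  by (induction c arbitrary: u) (auto simp: step_op_def)

lemma step_op_funpow_adjoint:
  assumes "\<And>u. u \<ge> a \<Longrightarrow> f u = 0" and "a + c \<le> K"
  shows "(\<Sum>u\<le>K. (step_op ^^ c) f u * g u) = (\<Sum>u\<le>K. f u * (step_op ^^ c) g u)"
  using assms(2)
proof (induction c arbitrary: g)
  case (Suc c)
  have "(\<Sum>u\<le>K. (step_op ^^ Suc c) f u * g u) = (\<Sum>u\<le>K. (step_op ^^ c) f u * step_op g u)"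
    using step_op_adjoint[of K "(step_op ^^ c) f" g] step_op_support[OF assms(1), where c = c] Suc.prems by simp
  also have "\<dots> = (\<Sum>u\<le>K. f u * (step_op ^^ Suc c) g u)"
    using Suc by (simp add: funpow_swap1)
  finally show ?case .
qed simp

lemma completions_support: "u > c \<Longrightarrow> completions c u = 0"
  unfolding completions_def by (rule step_op_support[where a = 1]) auto

text \<open>Evaluation at 0 is the pairing with the indicator of 0, and \<open>completions c\<close>
  is what this indicator becomes when the \<open>c\<close> steps are moved to the other
  side.\<close>

lemma step_op_funpow_at_0:
  assumes "c < K"
  shows "(step_op ^^ c) g 0 = (\<Sum>u\<le>K. completions c u * g u)"
proof -
  have "(\<Sum>u\<le>K. completions c u * g u) = (\<Sum>u\<le>K. (if u = 0 then 1 else 0) * (step_op ^^ c) g u)"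
    unfolding completions_def by (rule step_op_funpow_adjoint[where a = 1]) (use assms in auto)
  also have "\<dots> = (step_op ^^ c) g 0"
    by (simp add: if_distrib[of "\<lambda>x. x * _"] cong: if_cong)
  finally show ?thesis by simp
qed

lemma step_op_funpow_sym:
  "(step_op ^^ c) (\<lambda>u. h u * completions t u) 0 = (step_op ^^ t) (\<lambda>u. h u * completions c u) 0"
proof -
  have "(step_op ^^ c) (\<lambda>u. h u * completions t u) 0 = (\<Sum>u\<le>Suc (c + t). completions c u * (h u * completions t u))"
    by (rule step_op_funpow_at_0) simp
  also have "\<dots> = (\<Sum>u\<le>Suc (c + t). completions t u * (h u * completions c u))"
    by (simp only: mult_ac)
  also have "\<dots> = (step_op ^^ t) (\<lambda>u. h u * completions c u) 0"
    by (rule step_op_funpow_at_0[symmetric]) simp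
  finally show ?thesis .
qed

text \<open>Both sides are the pairing of \<open>h * completions c\<close> with
  \<open>h * completions t\<close> with the \<open>d\<close> middle steps applied to one of the
  two.\<close>

lemma sandwich_sym:
  "(step_op ^^ c) (\<lambda>u. h u * (step_op ^^ d) (\<lambda>u. h u * completions t u) u) 0 =
   (step_op ^^ t) (\<lambda>u. h u * (step_op ^^ d) (\<lambda>u. h u * completions c u) u) 0"
proof -
  \<comment> \<open>Large enough for the supports: \<open>completions c\<close> vanishes beyond
    \<open>c\<close>, and each middle step enlarges the support by at most one.\<close>
  define K where "K = Suc (c + d + t)"
  have "(step_op ^^ c) (\<lambda>u. h u * (step_op ^^ d) (\<lambda>u. h u * completions t u) u) 0 =
      (\<Sum>u\<le>K. (h u * completions c u) * (step_op ^^ d) (\<lambda>u. h u * completions t u) u)"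
    by (subst step_op_funpow_at_0[of c K]) (simp_all add: K_def mult_ac)
  also have "\<dots> = (\<Sum>u\<le>K. (step_op ^^ d) (\<lambda>u. h u * completions c u) u * (h u * completions t u))"
    by (rule step_op_funpow_adjoint[symmetric, where a = "Suc c"]) (auto simp: completions_support K_def)
  also have "\<dots> = (step_op ^^ t) (\<lambda>u. h u * (step_op ^^ d) (\<lambda>u. h u * completions c u) u) 0"
    by (subst step_op_funpow_at_0[of t K]) (simp_all add: K_def mult_ac)
  finally show ?thesis .
qed

text \<open>At the chain end the next letter is a leaf in a marked ordinary slot: one choice if the
  special slot is marked, two otherwise. So \<open>X = B\<close>, \<open>Y = 2 * B\<close>, and the
  combination is \<open>(2 * u + 1) * B\<close>, where \<open>B\<close> counts the rest of the word
  on one slot less.\<close>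

lemma joint_less:
  "joint c (Suc d + c) (Suc (Suc (Suc (d + t))) + c) 1 0 =
     (step_op ^^ c) (\<lambda>u. (2 * u + 1) * (step_op ^^ d) (\<lambda>u. (2 * u + 1) * completions t u) u) 0"
proof -
  let ?B = "\<lambda>s. (step_op ^^ d) (\<lambda>u. (2 * u + 1) * completions t u) (s - 1)"
  have base: "joint 0 (Suc d) (Suc (Suc (Suc (d + t)))) s p = (if Suc p = s then ?B s else 2 * ?B s)"
    if "p < s" for s p
  proof -
    have "joint 0 (Suc d) (Suc (Suc (Suc (d + t)))) s p =
        (\<Sum>i\<le>s. 0) + (\<Sum>i<s. if i \<in> {p, Suc p} then ?B s else 0)"
      unfolding joint_def
      by (rule count_SucI) (auto simp: count_parent_last)
    also have "\<dots> = card ({..<s} \<inter> {p, Suc p}) * ?B s"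
      by (simp only: sum_indicator_const finite_lessThan sum.neutral_const add_0)
    also have "{..<s} \<inter> {p, Suc p} = (if Suc p = s then {p} else {p, Suc p})"
      using that by auto
    finally show ?thesis by simp
  qed
  show ?thesis
    using joint_start[OF base, of "\<lambda>u. (2 * u + 1) * ?B (Suc u)" c] by simp
qed

text \<open>The chain ends with a leaf, whereas the parent of the last label is internal.\<close>

lemma joint_same: "joint e e r s p = 0"
proof -
  have "(chain_ends e p w \<and> parent_last e w) = False" for w
    by (induction e p w rule: chain_ends.induct) auto
  then show ?thesis
    unfolding joint_def by (simp only: count_False)
qed

text \<open>The first letter is a leaf in a marked ordinary slot other than \<open>q\<close>. It
  leaves \<open>s - 1\<close> ordinary slots, one of them reserved, hence \<open>s - 2\<close> in
  the argument of \<open>completions\<close>.\<close>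

lemma count_chain_ends_filled_last:
  assumes "q < s"
  shows "count (\<lambda>w. chain_ends 0 p w \<and> filled_last q w) (Suc (Suc t)) s =
    ((if p < s \<and> p \<noteq> q then 1 else 0) + (if Suc p < s \<and> Suc p \<noteq> q then 1 else 0)) * completions t (s - 2)"
proof -
  have d: "count (\<lambda>w. chain_ends 0 p ((i, False) # w) \<and> filled_last q ((i, False) # w)) (Suc t) (s - 1) =
      (if i \<in> {p, Suc p} - {q} then completions t (s - 2) else 0)" if "i < s" for i
  proof (cases "i \<in> {p, Suc p} - {q}")
    case True
    then have "count (\<lambda>w. chain_ends 0 p ((i, False) # w) \<and> filled_last q ((i, False) # w)) (Suc t) (s - 1) =
        count (filled_last (shift i False q)) (Suc t) (s - 1)"
      by (intro count_cong) auto
    moreover have "shift i False q < s - 1"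
      using True that assms by (auto simp: shift_def)
    ultimately show ?thesis using True by (simp add: count_filled_last numeral_2_eq_2)
  next
    case False
    then have "count (\<lambda>w. chain_ends 0 p ((i, False) # w) \<and> filled_last q ((i, False) # w)) (Suc t) (s - 1) =
        count (\<lambda>w. False) (Suc t) (s - 1)"
      by (intro count_cong) auto
    then show ?thesis by (simp only: count_False if_not_P[OF False])
  qed
  have "count (\<lambda>w. chain_ends 0 p w \<and> filled_last q w) (Suc (Suc t)) s =
     (\<Sum>i\<le>s. 0) + (\<Sum>i<s. if i \<in> {p, Suc p} - {q} then completions t (s - 2) else 0)"
    by (rule count_SucI[OF _ d]) auto
  also have "\<dots> = card ({..<s} \<inter> ({p, Suc p} - {q})) * completions t (s - 2)"
    by (simp only: sum_indicator_const finite_lessThan sum.neutral_const add_0)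
  also have "{..<s} \<inter> ({p, Suc p} - {q}) =
      (if p < s \<and> p \<noteq> q then {p} else {}) \<union> (if Suc p < s \<and> Suc p \<noteq> q then {Suc p} else {})"
    by auto
  also have "card \<dots> = (if p < s \<and> p \<noteq> q then 1 else 0) + (if Suc p < s \<and> Suc p \<noteq> q then 1 else 0)"
    by auto
  finally show ?thesis .
qed

lemma joint_1_0:
  assumes "p < s"
  shows "joint 1 0 (Suc (Suc (Suc t))) s p = (if Suc p = s then 2 * s else 4 * s - 2) * completions t (s - 1)"
proof -
  \<comment> \<open>\<open>?N i\<close> counts pairs of distinct ordinary slots: a marked one for
    the leaf that ends the chain, and \<open>i\<close> or \<open>i + 1\<close>, reserved for the
    last label. There are 2 * 2 pairs in general. If \<open>i\<close> was marked, both choices are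
    made from the same slots, and a special slot among them reduces the choices.\<close>
  let ?N = "\<lambda>i. (if Suc p = s then if i = s then 0 else 2 else if i \<in> {p, Suc p, s} then 2 else 4 :: nat)"
  have u: "count (\<lambda>w. chain_ends 1 p ((i, True) # w) \<and> parent_last 0 ((i, True) # w)) (Suc (Suc t)) (Suc s)
      = ?N i * completions t (s - 1)" if "i \<le> s" for i
  proof -
    define p' where "p' = (if i = p \<or> i = Suc p then i else shift i True p)"
    have "count (\<lambda>w. chain_ends 1 p ((i, True) # w) \<and> parent_last 0 ((i, True) # w)) (Suc (Suc t)) (Suc s) =
       count (\<lambda>w. (chain_ends 0 p' w \<and> filled_last i w) \<or> (chain_ends 0 p' w \<and> filled_last (Suc i) w)) (Suc (Suc t)) (Suc s)"
      by (rule count_cong) (auto simp: p'_def)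
    also have "\<dots> = count (\<lambda>w. chain_ends 0 p' w \<and> filled_last i w) (Suc (Suc t)) (Suc s) +
        count (\<lambda>w. chain_ends 0 p' w \<and> filled_last (Suc i) w) (Suc (Suc t)) (Suc s)"
      by (rule count_disjoint) (metis filled_last_unique n_not_Suc_n)
    \<comment> \<open>For \<open>i = s\<close> slot \<open>Suc i\<close> is the special one, to
      which \<open>count_chain_ends_filled_last\<close> does not apply.\<close>
    also have "count (\<lambda>w. chain_ends 0 p' w \<and> filled_last (Suc i) w) (Suc (Suc t)) (Suc s) =
       (if i = s then 0 else count (\<lambda>w. chain_ends 0 p' w \<and> filled_last (Suc i) w) (Suc (Suc t)) (Suc s))"
    proof (cases "i = s")
      case True
      then have "count (\<lambda>w. chain_ends 0 p' w \<and> filled_last (Suc i) w) (Suc (Suc t)) (Suc s) = count (\<lambda>w. False) (Suc (Suc t)) (Suc s)"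
        by (intro count_cong) (auto dest: filled_last_special)
      with True show ?thesis by simp
    qed simp
    finally have eq: "count (\<lambda>w. chain_ends 1 p ((i, True) # w) \<and> parent_last 0 ((i, True) # w)) (Suc (Suc t)) (Suc s) =
        (((if p' < Suc s \<and> p' \<noteq> i then 1 else 0) + (if Suc p' < Suc s \<and> Suc p' \<noteq> i then 1 else 0)) +
         (if i = s then 0 else (if p' < Suc s \<and> p' \<noteq> Suc i then 1 else 0) + (if p' < s \<and> p' \<noteq> i then 1 else 0))) * completions t (s - 1)"
      using that by (simp add: count_chain_ends_filled_last)
    consider "i < p" | "i = p" | "i = Suc p" | "i > Suc p" by linarith
    then show ?thesis
      unfolding eq by cases (use that assms in \<open>simp_all add: p'_def shift_def\<close>)
  qed
  have "joint 1 0 (Suc (Suc (Suc t))) s p = (\<Sum>i\<le>s. ?N i * completions t (s - 1)) + (\<Sum>i<s. 0)"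
    unfolding joint_def by (rule count_SucI[OF u]) auto
  also have "\<dots> = (\<Sum>i\<le>s. ?N i) * completions t (s - 1)"
    by (simp add: sum_distrib_right)
  also have "(\<Sum>i\<le>s. ?N i) = (if Suc p = s then 2 * s else 4 * s - 2)"
  proof (cases "Suc p = s")
    case True
    then show ?thesis by (simp flip: lessThan_Suc_atMost)
  next
    case False
    then have sub: "{p, Suc p, s} \<subseteq> {..s}" and c: "card {p, Suc p, s} = 3" using assms by auto
    have "(\<Sum>i\<le>s. ?N i) = (\<Sum>i\<in>{..s} - {p, Suc p, s}. ?N i) + (\<Sum>i\<in>{p, Suc p, s}. ?N i)"
      by (rule sum.subset_diff[OF sub]) simp
    also have "(\<Sum>i\<in>{..s} - {p, Suc p, s}. ?N i) = (\<Sum>i\<in>{..s} - {p, Suc p, s}. 4)"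
      by (rule sum.cong) (use False in auto)
    also have "\<dots> = (Suc s - 3) * 4"
      using card_Diff_subset[OF _ sub] c by simp
    also have "(\<Sum>i\<in>{p, Suc p, s}. ?N i) = (\<Sum>i\<in>{p, Suc p, s}. 2)"
      by (rule sum.cong) (use False in auto)
    also have "\<dots> = 6" by (simp only: sum_constant c) simp
    finally show ?thesis using False assms by simp
  qed
  finally show ?thesis .
qed

text \<open>The factor is the weighted combination of the two values in \<open>joint_1_0\<close> at
  \<open>s = u + 1\<close>; it equals (2u + 1)^2 + 1.\<close>

lemma joint_Suc:
  "joint (Suc c) c (Suc (Suc (Suc (t + c)))) 1 0 =
     (step_op ^^ c) (\<lambda>u. (2 * Suc u + u * (4 * Suc u - 2)) * completions t u) 0"
proof -
  have "joint (1 + c) (0 + c) (Suc (Suc (Suc t)) + c) 1 0 =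
     (step_op ^^ c) (\<lambda>u. (2 * Suc u + u * (4 * Suc u - 2)) * completions t u) 0"
    by (rule joint_start[where X = "\<lambda>s. 2 * s * completions t (s - 1)" and Y = "\<lambda>s. (4 * s - 2) * completions t (s - 1)"])
      (simp_all add: joint_1_0 algebra_simps del: One_nat_def)
  then show ?thesis
    by simp
qed

lemma joint_Suc_sym:
  "joint (Suc c) c (Suc (Suc (Suc (t + c)))) 1 0 = joint (Suc t) t (Suc (Suc (Suc (c + t)))) 1 0"
  unfolding joint_Suc by (rule step_op_funpow_sym)

text \<open>An internal letter followed by a leaf leaves the number of ordinary slots unchanged, so
  validity would force \<open>s = 0\<close>; but the marked slot \<open>p\<close> is ordinary and
  still open.\<close>

lemma joint_1_0_2:
  assumes "p < s"
  shows "joint 1 0 2 s p = 0"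
proof -
  have "{w. length w = 2 \<and> valid s w \<and> chain_ends 1 p w \<and> parent_last 0 w} = {}"
    using assms by (auto simp: length_Suc_conv numeral_2_eq_2 split: if_splits)
  then show ?thesis unfolding joint_def count_def by (simp only: card.empty)
qed

text \<open>One internal letter and two leaves force \<open>s = 1\<close>. The internal node takes
  the special slot, so that the marks move off slot 0; this slot is closed by a leaf, and the chain
  ends in the left slot of the internal node.\<close>

lemma joint_2_0_3:
  assumes "p < s"
  shows "joint 2 0 3 s p = (if s = 1 then 1 else 0)"
proof -
  have "{w. length w = 3 \<and> valid s w \<and> chain_ends 2 p w \<and> parent_last 0 w} =
    (if s = 1 then {[(1, True), (0, False), (0, False)]} else {})"
    using assms by (auto simp: length_Suc_conv numeral_2_eq_2 numeral_3_eq_3 shift_def split: if_splits)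
  then show ?thesis unfolding joint_def count_def by (cases "s = 1") (simp_all only: if_True if_False card.empty card_1_singleton_iff, simp)
qed

text \<open>The label 1 is always the letter \<open>(0, True)\<close>, after which the slots 0 and 1 are marked.\<close>

definition word_count :: "nat \<Rightarrow> nat \<Rightarrow> nat \<Rightarrow> nat" where
  "word_count n m k =
     count (\<lambda>w. chain_ends (m - 2) 0 w \<and> parent_last (k - 1) ((0, True) # w)) (2 * n - 1) 1"

lemma word_count_joint:
  assumes "k \<ge> 2"
  shows "word_count n m k = joint (m - 2) (k - 2) (2 * n - 1) 1 0"
proof -
  have "k - 1 = Suc (k - 2)" using assms by simp
  then show ?thesis by (simp add: word_count_def joint_def)
qed

lemma word_count_last_edge:
  assumes "n \<ge> 2"
  shows "word_count n (2 * n) (2 * n - 1) = 0"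
proof -
  define c where "c = 2 * n - 3"
  have "2 * n - 2 = 1 + c" "2 * n - 1 = 2 + c" "2 + c - 2 = 0 + c"
    using assms by (simp_all add: c_def)
  then have "word_count n (2 * n) (2 * n - 1) = joint (1 + c) (0 + c) (2 + c) 1 0"
    by (simp only: word_count_joint le_add1)
  also have "\<dots> = (step_op ^^ c) (\<lambda>u. 0) 0"
    by (rule joint_start[where X = "\<lambda>_. 0" and Y = "\<lambda>_. 0"]) (simp_all add: joint_1_0_2 del: One_nat_def)
  also have "(step_op ^^ c) (\<lambda>u. 0) u = 0" for u
    by (induction c arbitrary: u) (simp_all add: step_op_def)
  finally show ?thesis .
qed

text \<open>Label 2 as a leaf occupies the only ordinary slot of label 1, and the other slot cannot
  receive the leaf 2n.\<close>

lemma word_count_2_1: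
  assumes "n \<ge> 2"
  shows "word_count n 2 1 = 0"
proof -
  have "\<not> (chain_ends 0 0 w \<and> parent_last 0 ((0, True) # w))" if w: "length w = 2 * n - 1" "valid 1 w" for w
  proof -
    obtain i b v where "w = (i, b) # v"
      using w assms by (cases w) auto
    moreover from this have "v \<noteq> []"
      using w assms by auto
    ultimately show ?thesis using w filled_last_special[of 1 w] by auto
  qed
  then have "word_count n 2 1 = count (\<lambda>w. False) (2 * n - 1) 1"
    unfolding word_count_def by (intro count_cong) auto
  then show ?thesis by simp
qed

text \<open>Slot 0 of label 1 is reserved for 2n. Hence label 2 is internal in the special slot and
  label 3 is the leaf in its left slot. Only the special slot and the reserved slot are then
  open.\<close>

lemma word_count_3_1:
  assumes "n \<ge> 2"
  shows "word_count n 3 1 = completions (2 * n - 4) 0"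
proof -
  define t where "t = 2 * n - 4"
  have e: "(3::nat) - 2 = 1" "(1::nat) - 1 = 0" by simp_all
  have t: "2 * n - 1 = Suc (Suc (Suc t))" using assms by (simp add: t_def)
  have u: "count (\<lambda>w. chain_ends 1 0 ((i, True) # w) \<and> parent_last 0 ((0, True) # (i, True) # w)) (Suc (Suc t)) (Suc 1) =
      (if i = 1 then completions t 0 else 0)" if "i \<le> 1" for i
  proof (cases "i = 1")
    case True
    have "count (\<lambda>w. chain_ends 1 0 ((i, True) # w) \<and> parent_last 0 ((0, True) # (i, True) # w)) (Suc (Suc t)) (Suc 1) =
       count (\<lambda>w. chain_ends 0 1 w \<and> filled_last 0 w) (Suc (Suc t)) 2"
      by (rule trans[OF count_cong]) (auto simp: True shift_def numeral_2_eq_2)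
    with True show ?thesis by (simp add: count_chain_ends_filled_last)
  next
    case False
    with that have "i = 0" by simp
    have "count (\<lambda>w. chain_ends 1 0 ((i, True) # w) \<and> parent_last 0 ((0, True) # (i, True) # w)) (Suc (Suc t)) (Suc 1) =
       count (\<lambda>w. False) (Suc (Suc t)) (Suc 1)"
      by (rule count_cong) (use filled_last_special in \<open>auto simp: \<open>i = 0\<close> shift_def numeral_2_eq_2\<close>)
    with False show ?thesis by simp
  qed
  have "word_count n 3 1 = (\<Sum>i\<le>(1::nat). if i = 1 then completions t 0 else 0) + (\<Sum>i<(1::nat). 0)"
    unfolding word_count_def t e by (rule count_SucI) (simp_all only: u, simp)
  then show ?thesis by (simp add: t_def)
qed

lemma word_count_corner:
  assumes "n \<ge> 2"
  shows "word_count n (2 * n) (2 * n - 2) = completions (2 * n - 4) 0"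
proof -
  define c where "c = 2 * n - 4"
  have "2 * n - 2 = 2 + c" "2 * n - 1 = 3 + c" "2 + c - 2 = 0 + c"
    using assms by (simp_all add: c_def)
  then have "word_count n (2 * n) (2 * n - 2) = joint (2 + c) (0 + c) (3 + c) 1 0"
    by (simp only: word_count_joint le_add1)
  also have "\<dots> = (step_op ^^ c) (\<lambda>u. if u = 0 then 1 else 0) 0"
    by (rule joint_start[where X = "\<lambda>s. if s = 1 then 1 else 0" and Y = "\<lambda>s. if s = 1 then 1 else 0"])
      (simp_all add: joint_2_0_3 del: One_nat_def)
  finally show ?thesis
    by (simp add: completions_def c_def)
qed

text \<open>\<open>c\<close>, \<open>d\<close> and \<open>t\<close> are the numbers of labels
  strictly between 1 and \<open>m\<close>, between \<open>m\<close> and \<open>k\<close>, and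
  between \<open>k\<close> and 2n; the reflection exchanges \<open>c\<close> and
  \<open>t\<close>.\<close>

lemma word_count_less:
  assumes "m = c + 2" "k = c + d + 3" "2 * n = c + d + t + 4"
  shows "word_count n m k = (step_op ^^ c) (\<lambda>u. (2 * u + 1) *
    (step_op ^^ d) (\<lambda>u. (2 * u + 1) * completions t u) u) 0"
proof -
  have "m - 2 = c" "k - 2 = Suc d + c" "2 * n - 1 = Suc (Suc (Suc (d + t))) + c" "2 \<le> k"
    using assms by simp_all
  then show ?thesis
    by (simp only: word_count_joint joint_less)
qed

lemma word_count_Suc:
  assumes "m = c + 3" "k = c + 2" "2 * n = c + t + 4"
  shows "word_count n m k = joint (Suc c) c (Suc (Suc (Suc (t + c)))) 1 0"
proof -
  have "m - 2 = Suc c" "k - 2 = c" "2 * n - 1 = Suc (Suc (Suc (t + c)))" "2 \<le> k"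
    using assms by simp_all
  then show ?thesis
    by (simp only: word_count_joint)
qed

lemma word_count_sym:
  assumes "n \<ge> 1" "(m, k) \<in> Up n"
  shows "word_count n (2 * n + 1 - k) (2 * n + 1 - m) = word_count n m k"
proof -
  have range: "2 \<le> m" "m \<le> 2 * n" "1 \<le> k" "k \<le> 2 * n - 1"
    using assms by (auto simp: Up_def)
  show ?thesis
  proof (cases "n = 1")
    case True
    with range show ?thesis by simp
  next
    case False
    with assms have n: "n \<ge> 2" by simp
    from assms(2) have "m - 1 \<le> k \<or> (m = 3 \<and> k = 1) \<or> (m = 2 * n \<and> k = 2 * n - 2)"
      by (simp add: Up_def)
    moreover have "m < k \<or> m = k \<or> m = Suc k" if "m - 1 \<le> k"
      using that by linarith
    moreover have "(2 \<le> k \<and> k < 2 * n - 1) \<or> (m = 2 \<and> k = 1) \<or> (m = 2 * n \<and> k = 2 * n - 1)" if "m = Suc k"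
      using that range by auto
    \<comment> \<open>The reflection preserves each of the first three cases and exchanges (2, 1)
      with (2n, 2n - 1) and (3, 1) with (2n, 2n - 2).\<close>
    ultimately consider "m < k" | "m = k" | "m = Suc k" "2 \<le> k" "k < 2 * n - 1" | "m = 2" "k = 1"
      | "m = 2 * n" "k = 2 * n - 1" | "m = 3" "k = 1" | "m = 2 * n" "k = 2 * n - 2"
      by blast
    then show ?thesis
    proof cases
      case 1
      define c d t where "c = m - 2" and "d = k - m - 1" and "t = 2 * n - k - 1"
      with 1 range have "m = c + 2" "k = c + d + 3" "2 * n = c + d + t + 4"
        and "2 * n + 1 - k = t + 2" "2 * n + 1 - m = t + d + 3" "2 * n = t + d + c + 4"
        by auto
      then have "word_count n m k = (step_op ^^ c) (\<lambda>u. (2 * u + 1) * (step_op ^^ d) (\<lambda>u. (2 * u + 1) * completions t u) u) 0"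
        and "word_count n (2 * n + 1 - k) (2 * n + 1 - m) =
          (step_op ^^ t) (\<lambda>u. (2 * u + 1) * (step_op ^^ d) (\<lambda>u. (2 * u + 1) * completions c u) u) 0"
        using word_count_less by blast+
      then show ?thesis
        using sandwich_sym[of c] by (simp only:)
    next
      case 2
      with range show ?thesis
        by (simp add: word_count_joint joint_same)
    next
      case 3
      define c t where "c = k - 2" and "t = 2 * n - k - 2"
      with 3 range have "m = c + 3" "k = c + 2" "2 * n = c + t + 4"
        and "2 * n + 1 - k = t + 3" "2 * n + 1 - m = t + 2" "2 * n = t + c + 4"
        by auto
      then have "word_count n m k = joint (Suc c) c (Suc (Suc (Suc (t + c)))) 1 0"
        and "word_count n (2 * n + 1 - k) (2 * n + 1 - m) = joint (Suc t) t (Suc (Suc (Suc (c + t)))) 1 0"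
        using word_count_Suc by blast+
      then show ?thesis
        using joint_Suc_sym[of c t] by (simp only:)
    next
      case 4
      then have "2 * n + 1 - k = 2 * n" "2 * n + 1 - m = 2 * n - 1" by simp_all
      with 4 n show ?thesis by (simp only: word_count_2_1 word_count_last_edge)
    next
      case 5
      with n have "2 * n + 1 - k = 2" "2 * n + 1 - m = 1" by simp_all
      with 5 n show ?thesis by (simp only: word_count_2_1 word_count_last_edge)
    next
      case 6
      with n show ?thesis by (simp add: word_count_3_1 word_count_corner del: One_nat_def)
    next
      case 7
      with n have "2 * n + 1 - k = 3" by simp
      with 7 n show ?thesis by (simp add: word_count_3_1 word_count_corner del: One_nat_def)
    qed
  qed
qed

section \<open>Increasing trees\<close>

lemma in_children_iff:
  "b \<in> children t a \<longleftrightarrow> (\<exists>l r. \<langle>l, a, r\<rangle> \<in> subtrees t \<and> b \<in> root_labels l \<union> root_labels r)"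
  unfolding children_def by blast

lemma children_simps [simp]:
  "children \<langle>\<rangle> a = {}"
  "children \<langle>l, x, r\<rangle> a = (if a = x then root_labels l \<union> root_labels r else {}) \<union> children l a \<union> children r a"
  unfolding set_eq_iff Un_iff in_children_iff by auto

lemma root_labels_subset: "root_labels t \<subseteq> set_tree t"
  by (cases t) auto

lemma children_subset: "children t a \<subseteq> set_tree t"
  by (induction t) (use root_labels_subset in auto)

lemma children_eq_empty: "a \<notin> set_tree t \<Longrightarrow> children t a = {}"
  by (induction t) auto

lemma heap_root: "heap \<langle>l, x, r\<rangle> \<Longrightarrow> a \<in> set_tree \<langle>l, x, r\<rangle> \<Longrightarrow> x \<le> a"
  by auto

lemma heap_if_children_greater:
  "\<forall>a\<in>set_tree t. \<forall>b\<in>children t a. a < b \<Longrightarrow> heap t"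
proof (induction t)
  case (Node l x r)
  have hl: "heap l" and hr: "heap r"
    using Node by (auto simp del: heap.simps)
  have "x \<le> a" if a: "a \<in> set_tree v" and v: "v = l \<or> v = r" for a v
  proof -
    obtain v1 y v2 where y: "v = \<langle>v1, y, v2\<rangle>" using a by (cases v) auto
    then have "y \<in> children \<langle>l, x, r\<rangle> x" using v by auto
    then have "x < y" using Node.prems by simp
    also have "y \<le> a" using heap_root y a v hl hr by blast
    finally show ?thesis by simp
  qed
  then show ?case using hl hr by auto
qed simp

lemma children_greater_if_heap:
  "heap t \<Longrightarrow> distinct (inorder t) \<Longrightarrow> b \<in> children t a \<Longrightarrow> a < b"
proof (induction t)
  case (Node l x r)
  have x: "x < b" if "b \<in> set_tree l \<union> set_tree r"
    using Node.prems that by (auto simp: order.strict_iff_order)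
  from Node.prems(3) consider "a = x" "b \<in> root_labels l \<union> root_labels r" | "b \<in> children l a" | "b \<in> children r a"
    by (auto split: if_splits)
  then show ?case
    by cases (use Node x root_labels_subset in auto)
qed simp

text \<open>A tree with N nodes and N different labels has no repetitions, so one equation of
  multisets expresses the bijective labelling. In this form it splits well when a root is removed.
  \<open>heap\<close> is not strict; strictness comes back from distinctness.\<close>

lemma increasing_tree_iff:
  assumes "N \<ge> 1"
  shows "increasing_tree N t \<longleftrightarrow> heap t \<and> mset (inorder t) = mset [1..<Suc N]"
proof
  assume t: "increasing_tree N t"
  then have "heap t"
    by (intro heap_if_children_greater) (simp add: increasing_tree_def)
  moreover from t have set: "set (inorder t) = {1..N}" and "length (inorder t) = N"
    by (simp_all add: increasing_tree_def)
  then have "distinct (inorder t)"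
    by (intro card_distinct) simp
  with set have "mset (inorder t) = mset [1..<Suc N]"
    using set_eq_iff_mset_eq_distinct[of "inorder t" "[1..<Suc N]"]
    by (simp add: atLeastLessThanSuc_atLeastAtMost del: upt_Suc)
  ultimately show "heap t \<and> mset (inorder t) = mset [1..<Suc N]" ..
next
  assume t: "heap t \<and> mset (inorder t) = mset [1..<Suc N]"
  then have mset: "mset (inorder t) = mset [1..<Suc N]" and heap: "heap t"
    by simp_all
  have set: "set_tree t = {1..N}"
    using mset_eq_setD[OF mset] by auto
  have distinct: "distinct (inorder t)"
    using mset_eq_imp_distinct_iff[OF mset] by simp
  have size: "size t = N"
    using mset_eq_length[OF mset] by (simp del: upt_Suc)
  have root: "root_labels t = {1}"
  proof (cases t)
    case (Node l x r)
    have "1 \<in> set_tree t"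
      unfolding set using assms by simp
    then have "x \<le> 1"
      using heap_root[of l x r 1] heap unfolding Node by simp
    moreover have "x \<in> set_tree t"
      unfolding Node by simp
    then have "1 \<le> x"
      unfolding set by simp
    ultimately have "x = 1"
      by simp
    with Node show ?thesis by simp
  qed (use assms set in auto)
  show "increasing_tree N t"
    unfolding increasing_tree_def
    using size set root children_greater_if_heap[OF heap distinct] by blast
qed

text \<open>\<open>full_tree\<close> and \<open>spine_tree\<close> are the shapes of complete trees of odd and of even size.\<close>

fun full_tree :: "'a tree \<Rightarrow> bool" where
  "full_tree \<langle>\<rangle> \<longleftrightarrow> False"
| "full_tree \<langle>l, a, r\<rangle> \<longleftrightarrow> l = \<langle>\<rangle> \<and> r = \<langle>\<rangle> \<or> full_tree l \<and> full_tree r"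

fun spine_tree :: "'a tree \<Rightarrow> bool" where
  "spine_tree \<langle>\<rangle> \<longleftrightarrow> True"
| "spine_tree \<langle>l, a, r\<rangle> \<longleftrightarrow> full_tree l \<and> spine_tree r"

abbreviation node_cond :: "nat \<Rightarrow> nat tree \<Rightarrow> bool" where
  "node_cond c t \<equiv> \<forall>l a r. \<langle>l, a, r\<rangle> \<in> subtrees t \<longrightarrow>
     (if a = c then l \<noteq> \<langle>\<rangle> \<and> r = \<langle>\<rangle> else l = \<langle>\<rangle> \<and> r = \<langle>\<rangle> \<or> l \<noteq> \<langle>\<rangle> \<and> r \<noteq> \<langle>\<rangle>)"

lemma all_subtrees_Node:
  "(\<forall>l' a r'. \<langle>l', a, r'\<rangle> \<in> subtrees \<langle>l, x, r\<rangle> \<longrightarrow> Q l' a r') \<longleftrightarrow>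
     Q l x r \<and> (\<forall>l' a r'. \<langle>l', a, r'\<rangle> \<in> subtrees l \<longrightarrow> Q l' a r') \<and>
     (\<forall>l' a r'. \<langle>l', a, r'\<rangle> \<in> subtrees r \<longrightarrow> Q l' a r')"
  by auto

lemma node_cond_Node:
  "node_cond c \<langle>l, x, r\<rangle> \<longleftrightarrow>
     (if x = c then l \<noteq> \<langle>\<rangle> \<and> r = \<langle>\<rangle> else l = \<langle>\<rangle> \<and> r = \<langle>\<rangle> \<or> l \<noteq> \<langle>\<rangle> \<and> r \<noteq> \<langle>\<rangle>) \<and>
     node_cond c l \<and> node_cond c r"
  by (rule all_subtrees_Node)

lemma node_cond_full: "c \<notin> set_tree t \<Longrightarrow> node_cond c t \<longleftrightarrow> t = \<langle>\<rangle> \<or> full_tree t"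
proof (induction t)
  case (Node l x r)
  then show ?case
    unfolding node_cond_Node by auto
qed simp

lemma rightmost_in: "t \<noteq> \<langle>\<rangle> \<Longrightarrow> rightmost t \<in> set_tree t"
  by (induction t rule: rightmost.induct) auto

text \<open>Along the right branch the exceptional node stays in the right subtree; by distinctness
  its label does not occur in the left subtrees, which are therefore full.\<close>

lemma node_cond_spine:
  "distinct (inorder t) \<Longrightarrow> t \<noteq> \<langle>\<rangle> \<Longrightarrow> node_cond (rightmost t) t \<longleftrightarrow> spine_tree t"
proof (induction t)
  case (Node l x r)
  show ?case
  proof (cases "r = \<langle>\<rangle>")
    case True
    with Node.prems have "x \<notin> set_tree l" by simp
    with True show ?thesis
      unfolding node_cond_Node by (auto simp: node_cond_full)
  next
    case False
    with Node.prems rightmost_in[of r] have "rightmost r \<notin> set_tree l" "rightmost r \<noteq> x" by auto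
    with False Node show ?thesis
      unfolding node_cond_Node by (auto simp: node_cond_full)
  qed
qed simp

lemma complete_increasing_trees_iff:
  assumes "n \<ge> 1"
  shows "t \<in> complete_increasing_trees (2 * n) \<longleftrightarrow>
     spine_tree t \<and> heap t \<and> mset (inorder t) = mset [1..<Suc (2 * n)]"
proof -
  have "distinct (inorder t) \<and> t \<noteq> \<langle>\<rangle>" if "mset (inorder t) = mset [1..<Suc (2 * n)]"
    using that assms mset_eq_imp_distinct_iff[OF that] by auto
  moreover have "increasing_tree (2 * n) t \<longleftrightarrow> heap t \<and> mset (inorder t) = mset [1..<Suc (2 * n)]"
    using assms by (intro increasing_tree_iff) simp
  moreover have "t \<in> complete_increasing_trees (2 * n) \<longleftrightarrow> increasing_tree (2 * n) t \<and> node_cond (rightmost t) t"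
    by (simp add: complete_increasing_trees_def)
  ultimately show ?thesis
    using node_cond_spine[of t] by blast
qed

section \<open>The minimal chain and the parent of the largest label, by recursion on the
  tree\<close>

fun tree_eoc :: "nat tree \<Rightarrow> nat" where
  "tree_eoc \<langle>\<rangle> = undefined"
| "tree_eoc \<langle>l, a, r\<rangle> =
     (if l = \<langle>\<rangle> then a else if r = \<langle>\<rangle> \<or> value l < value r then tree_eoc l else tree_eoc r)"

text \<open>The pair need not be the children of one node: it will also be two neighbouring marked
  slots of a forest. An empty left subtree suffices to recognise a leaf in \<open>tree_eoc\<close>,
  since full and spine trees never lack only the left child.\<close>

abbreviation pair_eoc :: "nat tree \<Rightarrow> nat tree \<Rightarrow> nat" where
  "pair_eoc l r \<equiv> if r = \<langle>\<rangle> \<or> value l < value r then tree_eoc l else tree_eoc r"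

lemma full_tree_not_Leaf: "full_tree t \<Longrightarrow> t \<noteq> \<langle>\<rangle>"
  by auto

lemma children_subtree:
  "distinct (inorder t) \<Longrightarrow> u \<in> subtrees t \<Longrightarrow> b \<in> set_tree u \<Longrightarrow> children t b = children u b"
proof (induction t)
  case (Node l x r)
  have sub: "set_tree u \<subseteq> set_tree v" if "u \<in> subtrees v" for u v :: "nat tree"
    using that by (induction v) auto
  from Node.prems(2) consider "u = \<langle>l, x, r\<rangle>" | "u \<in> subtrees l" | "u \<in> subtrees r" by auto
  then show ?case
  proof cases
    case 2
    then have "b \<in> set_tree l" using sub Node.prems(3) by blast
    with Node.prems have "b \<noteq> x" "b \<notin> set_tree r" by auto
    with 2 Node show ?thesis by (simp add: children_eq_empty)
  next
    case 3
    then have "b \<in> set_tree r" using sub Node.prems(3) by blast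
    with Node.prems have "b \<noteq> x" "b \<notin> set_tree l" by auto
    with 3 Node show ?thesis by (simp add: children_eq_empty)
  qed simp
qed simp

text \<open>\<open>min_child t\<close> refers to the whole tree, so \<open>t\<close> is kept fixed
  and the induction runs over the subtree \<open>u\<close> in which the chain starts.\<close>

lemma chain_end:
  assumes "distinct (inorder t)" and "u \<in> subtrees t" and "full_tree u \<or> spine_tree u" and "u \<noteq> \<langle>\<rangle>"
  defines "P \<equiv> \<lambda>j. children t ((min_child t ^^ j) (value u)) = {}"
  shows "(\<exists>j. P j) \<and> (min_child t ^^ (LEAST j. P j)) (value u) = tree_eoc u"
  using assms(2-4) unfolding P_def
proof (induction u)
  case (Node l x r)
  have c: "children t x = root_labels l \<union> root_labels r"
  proof -
    have "children t x = children \<langle>l, x, r\<rangle> x"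
      by (rule children_subtree[OF assms(1) Node.prems(1)]) simp
    moreover have "distinct (inorder \<langle>l, x, r\<rangle>)"
    proof -
      have "distinct (inorder u)" if "u \<in> subtrees t" "distinct (inorder t)" for u t :: "nat tree"
        using that by (induction t) auto
      then show ?thesis using Node.prems(1) assms(1) by blast
    qed
    ultimately show ?thesis by (simp add: children_eq_empty)
  qed
  show ?case
  proof (cases "l = \<langle>\<rangle>")
    case True
    with Node.prems have "r = \<langle>\<rangle>" by auto
    with True c have P0: "children t ((min_child t ^^ 0) x) = {}" by simp
    then have "(LEAST j. children t ((min_child t ^^ j) x) = {}) = 0" by (rule Least_eq_0)
    with P0 True show ?thesis by (auto intro: exI[of _ 0])
  next
    case False
    define v where "v = (if r = \<langle>\<rangle> \<or> value l < value r then l else r)"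
    have v: "v \<noteq> \<langle>\<rangle>" "full_tree v \<or> spine_tree v" "v \<in> subtrees t"
    proof -
      show "v \<noteq> \<langle>\<rangle>" "full_tree v \<or> spine_tree v"
        using False Node.prems by (auto simp: v_def)
      have "w \<in> subtrees t" if "\<langle>l, x, r\<rangle> \<in> subtrees t" "w = l \<or> w = r" for w and t :: "nat tree"
      proof -
        have "u \<in> subtrees u" for u :: "nat tree" by (cases u) auto
        then show ?thesis using that by (induction t) auto
      qed
      then show "v \<in> subtrees t" using Node.prems(1) by (auto simp: v_def)
    qed
    have m: "min_child t x = value v"
      using False by (cases l; cases r) (auto simp: min_child_def c v_def)
    have IH: "(\<exists>j. children t ((min_child t ^^ j) (value v)) = {}) \<and>
        (min_child t ^^ (LEAST j. children t ((min_child t ^^ j) (value v)) = {})) (value v) = tree_eoc v"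
      using Node.IH v unfolding v_def by (auto split: if_splits)
    have n0: "children t ((min_child t ^^ 0) x) \<noteq> {}"
      using False c by (cases l) auto
    have shift: "(min_child t ^^ Suc j) x = (min_child t ^^ j) (value v)" for j
      by (simp only: funpow_Suc_right comp_apply m)
    from IH obtain j where j: "children t ((min_child t ^^ Suc j) x) = {}"
      unfolding shift by blast
    \<comment> \<open>The root has children, so the chain does not stop at index 0 and the first
      stop moves by one.\<close>
    have "(LEAST j. children t ((min_child t ^^ j) x) = {}) =
        Suc (LEAST j. children t ((min_child t ^^ Suc j) x) = {})"
      by (rule Least_Suc[OF j n0])
    then have "(min_child t ^^ (LEAST j. children t ((min_child t ^^ j) x) = {})) x = tree_eoc v"
      using IH by (simp only: shift)
    moreover have "tree_eoc \<langle>l, x, r\<rangle> = tree_eoc v"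
      using False by (simp add: v_def)
    ultimately show ?thesis using j by (auto simp del: funpow.simps)
  qed
qed simp

lemma eoc_eq_tree_eoc:
  assumes "distinct (inorder t)" "spine_tree t" "root_labels t = {1}"
  shows "eoc t = tree_eoc t"
proof -
  have "t \<noteq> \<langle>\<rangle>" "value t = 1" "t \<in> subtrees t" using assms(3) by (cases t; simp)+
  with chain_end[of t t] assms show ?thesis by (simp add: eoc_def min_chain_def)
qed

text \<open>Distinct labels give each node at most one parent; this makes the \<open>THE\<close> in
  \<open>pom\<close> well defined.\<close>

lemma children_unique:
  "distinct (inorder t) \<Longrightarrow> b \<in> children t k \<Longrightarrow> b \<in> children t k' \<Longrightarrow> k = k'"
proof (induction t)
  case (Node l x r)
  have nr: "b \<notin> children t k" if "distinct (inorder t)" "b \<in> root_labels t" for t k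
  proof (cases t)
    case (Node l x r)
    with that root_labels_subset[of l] root_labels_subset[of r] children_subset[of l k] children_subset[of r k]
    show ?thesis by auto
  qed simp
  from Node.prems(1) have d: "distinct (inorder l)" "distinct (inorder r)" "set_tree l \<inter> set_tree r = {}" by auto
  have sub: "root_labels l \<union> children l a \<subseteq> set_tree l" "root_labels r \<union> children r a \<subseteq> set_tree r" for a
    using root_labels_subset children_subset by blast+
  show ?case
  proof (cases "b \<in> set_tree l")
    case True
    then have "b \<notin> set_tree r" using d by auto
    then have "b \<notin> root_labels r" "b \<notin> children r a" for a using sub by blast+
    then show ?thesis
      using Node.prems(2,3) Node.IH(1)[OF d(1)] nr[OF d(1)] by (auto split: if_splits)
  next
    case False
    then have "b \<notin> root_labels l" "b \<notin> children l a" for a using sub by blast+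
    then show ?thesis
      using Node.prems(2,3) Node.IH(2)[OF d(2)] nr[OF d(2)] by (auto split: if_splits)
  qed
qed simp

lemma children_exists:
  "b \<in> set_tree t \<Longrightarrow> b \<notin> root_labels t \<Longrightarrow> \<exists>k. b \<in> children t k"
proof (induction t)
  case (Node l x r)
  show ?case
  proof (cases "b \<in> root_labels l \<union> root_labels r")
    case False
    with Node obtain k where "b \<in> children l k \<union> children r k" by auto
    then show ?thesis by (intro exI[of _ k]) auto
  qed auto
qed simp

lemma pom_eq_iff:
  assumes "distinct (inorder t)" "size t \<in> set_tree t" "size t \<notin> root_labels t"
  shows "pom t = k \<longleftrightarrow> size t \<in> children t k"
proof -
  obtain k' where k': "size t \<in> children t k'"
    using children_exists[OF assms(2,3)] by blast
  moreover have "pom t = k'"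
    unfolding pom_def using k' children_unique[OF assms(1)] by blast
  ultimately show ?thesis
    using children_unique[OF assms(1)] by blast
qed

section \<open>Words and trees\<close>

text \<open>
  \<open>build j w\<close> lists, slot by slot, the subtrees that the word \<open>w\<close> grows with the labels
  \<open>j + 1, j + 2, \<dots>\<close>; the last entry belongs to the special slot.
\<close>

fun build :: "nat \<Rightarrow> (nat \<times> bool) list \<Rightarrow> nat tree list" where
  "build j [] = [\<langle>\<rangle>]"
| "build j ((i, b) # w) = (let F = build (Suc j) w in
     if b then take i F @ \<langle>F ! i, Suc j, F ! Suc i\<rangle> # drop (Suc (Suc i)) F
     else take i F @ \<langle>\<langle>\<rangle>, Suc j, \<langle>\<rangle>\<rangle> # drop i F)"

definition forest_shape :: "nat tree list \<Rightarrow> bool" where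
  "forest_shape F \<longleftrightarrow> F \<noteq> [] \<and> (\<forall>t\<in>set (butlast F). full_tree t) \<and> spine_tree (last F)"

abbreviation labels :: "nat tree list \<Rightarrow> nat list" where
  "labels F \<equiv> concat (map inorder F)"

text \<open>The image of \<open>build j\<close> on valid words of length \<open>r\<close> over
  \<open>s\<close> ordinary slots; \<open>build_forests\<close>, \<open>build_inj\<close> and
  \<open>build_surj\<close> establish the bijection.\<close>

definition forests :: "nat \<Rightarrow> nat \<Rightarrow> nat \<Rightarrow> nat tree list set" where
  "forests j r s = {F. length F = Suc s \<and> forest_shape F \<and> (\<forall>t\<in>set F. heap t) \<and>
     mset (labels F) = mset [Suc j..<Suc (j + r)]}"

lemma upt_shift: "[Suc j..<Suc (j + Suc r)] = Suc j # [Suc (Suc j)..<Suc (Suc j + r)]"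
  by (subst upt_conv_Cons) simp_all

lemma forests_labels:
  assumes "F \<in> forests j r s" "t \<in> set F" "a \<in> set_tree t"
  shows "j < a" "a \<le> j + r"
proof -
  have "a \<in> set (labels F)" using assms(2,3) by auto
  also have "\<dots> = {Suc j..<Suc (j + r)}"
    using assms(1) mset_eq_setD[of "labels F" "[Suc j..<Suc (j + r)]"] by (simp add: forests_def del: upt_Suc)
  finally show "j < a" "a \<le> j + r" by auto
qed

lemma forests_full:
  assumes "F \<in> forests j r s" "p < s"
  shows "full_tree (F ! p)"
proof -
  have "F ! p = butlast F ! p" "p < length (butlast F)"
    using assms by (auto simp: forests_def nth_butlast)
  then show ?thesis
    using assms(1) nth_mem[of p "butlast F"] by (auto simp: forests_def forest_shape_def)
qed

lemma split_pair: "Suc i < length F \<Longrightarrow> \<exists>A l r B. F = A @ l # r # B \<and> length A = i"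
  by (intro exI[of _ "take i F"] exI[of _ "F ! i"] exI[of _ "F ! Suc i"] exI[of _ "drop (Suc (Suc i)) F"])
    (simp add: Cons_nth_drop_Suc)

text \<open>For \<open>B = []\<close> the new node is in the special slot: \<open>l\<close> belongs
  to an ordinary slot and \<open>r\<close> to the new special slot, matching the recursion of
  \<open>spine_tree\<close>. The condition on \<open>l\<close> excludes the leaf case of
  \<open>full_tree\<close>.\<close>

lemma forest_shape_internal:
  assumes "l \<noteq> \<langle>\<rangle>"
  shows "forest_shape (A @ \<langle>l, a, r\<rangle> # B) \<longleftrightarrow> forest_shape (A @ l # r # B)"
  using assms by (cases "B = []") (auto simp: forest_shape_def butlast_append)

lemma forest_shape_leaf:
  "forest_shape (A @ \<langle>\<langle>\<rangle>, a, \<langle>\<rangle>\<rangle> # B) \<longleftrightarrow> B \<noteq> [] \<and> forest_shape (A @ B)"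
  by (cases "B = []") (auto simp: forest_shape_def butlast_append)

text \<open>The heap condition at the new root is automatic, because \<open>Suc j\<close> is smaller
  than all labels placed later.\<close>

lemma forests_internal:
  assumes "l \<noteq> \<langle>\<rangle>"
  shows "A @ \<langle>l, Suc j, r\<rangle> # B \<in> forests j (Suc n) s \<longleftrightarrow> A @ l # r # B \<in> forests (Suc j) n (Suc s)"
proof -
  have "heap \<langle>l, Suc j, r\<rangle> \<longleftrightarrow> heap l \<and> heap r"
    if "mset (labels (A @ l # r # B)) = mset [Suc (Suc j)..<Suc (Suc j + n)]"
  proof -
    have "set (labels (A @ l # r # B)) = {Suc (Suc j)..<Suc (Suc j + n)}"
      using mset_eq_setD[OF that] by (simp del: upt_Suc)
    moreover have "set_tree l \<union> set_tree r \<subseteq> set (labels (A @ l # r # B))"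
      by auto
    ultimately have "\<forall>x\<in>set_tree l \<union> set_tree r. Suc j \<le> x"
      by (auto simp del: set_concat)
    then show ?thesis by simp
  qed
  moreover have "mset (labels (A @ \<langle>l, Suc j, r\<rangle> # B)) = add_mset (Suc j) (mset (labels (A @ l # r # B)))"
    by simp
  then have "mset (labels (A @ \<langle>l, Suc j, r\<rangle> # B)) = mset [Suc j..<Suc (j + Suc n)] \<longleftrightarrow>
      mset (labels (A @ l # r # B)) = mset [Suc (Suc j)..<Suc (Suc j + n)]"
    unfolding upt_shift by simp
  ultimately show ?thesis
    unfolding forests_def mem_Collect_eq forest_shape_internal[OF assms] by auto
qed

lemma forests_leaf:
  "A @ \<langle>\<langle>\<rangle>, Suc j, \<langle>\<rangle>\<rangle> # B \<in> forests j (Suc n) s \<longleftrightarrow> 0 < s \<and> B \<noteq> [] \<and> A @ B \<in> forests (Suc j) n (s - 1)"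
proof -
  have "mset (labels (A @ \<langle>\<langle>\<rangle>, Suc j, \<langle>\<rangle>\<rangle> # B)) = add_mset (Suc j) (mset (labels (A @ B)))"
    by simp
  then have "mset (labels (A @ \<langle>\<langle>\<rangle>, Suc j, \<langle>\<rangle>\<rangle> # B)) = mset [Suc j..<Suc (j + Suc n)] \<longleftrightarrow>
      mset (labels (A @ B)) = mset [Suc (Suc j)..<Suc (Suc j + n)]"
    unfolding upt_shift by simp
  then show ?thesis
    unfolding forests_def mem_Collect_eq forest_shape_leaf by (cases B) auto
qed

lemma build_internal:
  assumes "build (Suc j) w = A @ l # r # B" "length A = i"
  shows "build j ((i, True) # w) = A @ \<langle>l, Suc j, r\<rangle> # B"
  using assms by (simp add: Let_def nth_append)

lemma build_leaf:
  assumes "build (Suc j) w = A @ B" "length A = i"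
  shows "build j ((i, False) # w) = A @ \<langle>\<langle>\<rangle>, Suc j, \<langle>\<rangle>\<rangle> # B"
  using assms by (simp add: Let_def)

text \<open>The membership in \<open>forests\<close> is a hypothesis here so that the rule can serve
  in the induction that proves \<open>build_forests\<close>; \<open>build_Cons_cases\<close>
  discharges it afterwards.\<close>

lemma build_cases [consumes 2, case_names internal leaf]:
  assumes "valid s ((i, b) # w)"
    and F: "\<forall>s. valid s w \<longrightarrow> build (Suc j) w \<in> forests (Suc j) (length w) s"
  obtains A l r B where "b" "i \<le> s" "valid (Suc s) w" "length A = i" "l \<noteq> \<langle>\<rangle>"
      "build (Suc j) w = A @ l # r # B" "build j ((i, b) # w) = A @ \<langle>l, Suc j, r\<rangle> # B"
    | A B where "\<not> b" "i < s" "valid (s - 1) w" "length A = i" "B \<noteq> []"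
      "build (Suc j) w = A @ B" "build j ((i, b) # w) = A @ \<langle>\<langle>\<rangle>, Suc j, \<langle>\<rangle>\<rangle> # B"
proof (cases b)
  case True
  with assms have v: "i \<le> s" "valid (Suc s) w" by auto
  note G = F[rule_format, OF v(2)]
  then have "Suc i < length (build (Suc j) w)" using v by (simp add: forests_def)
  then obtain A l r B where sp: "build (Suc j) w = A @ l # r # B" "length A = i"
    using split_pair by blast
  have "full_tree (build (Suc j) w ! i)" using forests_full[OF G, of i] v by simp
  then have "l \<noteq> \<langle>\<rangle>" using sp by (auto simp: nth_append)
  moreover have "build j ((i, b) # w) = A @ \<langle>l, Suc j, r\<rangle> # B"
    using True build_internal[OF sp] by (simp del: build.simps)
  ultimately show ?thesis by (intro that(1)[OF True v sp(2) _ sp(1)])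
next
  case False
  with assms have v: "i < s" "valid (s - 1) w" by auto
  note G = F[rule_format, OF v(2)]
  then have len: "i < length (build (Suc j) w)" using v by (simp add: forests_def)
  define A B where "A = take i (build (Suc j) w)" and "B = drop i (build (Suc j) w)"
  have sp: "build (Suc j) w = A @ B" "length A = i" "B \<noteq> []"
    using len by (auto simp: A_def B_def)
  have "build j ((i, b) # w) = A @ \<langle>\<langle>\<rangle>, Suc j, \<langle>\<rangle>\<rangle> # B"
    using False build_leaf[OF sp(1,2)] by (simp del: build.simps)
  then show ?thesis by (rule that(2)[OF False v sp(2,3,1)])
qed

lemma build_forests: "valid s w \<Longrightarrow> build j w \<in> forests j (length w) s"
proof (induction w arbitrary: j s)
  case Nil
  then show ?case by (simp add: forests_def forest_shape_def)
next
  case (Cons x w)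
  obtain i b where x: "x = (i, b)" by force
  have F: "\<forall>s. valid s w \<longrightarrow> build (Suc j) w \<in> forests (Suc j) (length w) s"
    using Cons.IH by blast
  from Cons.prems[unfolded x] F show ?case
  proof (cases rule: build_cases)
    case (internal A l r B)
    then show ?thesis using F[rule_format, of "Suc s"] unfolding x by (simp del: build.simps add: forests_internal)
  next
    case (leaf A B)
    then show ?thesis using F[rule_format, of "s - 1"] unfolding x by (simp del: build.simps add: forests_leaf)
  qed
qed

lemma build_Cons_cases [consumes 1, case_names internal leaf]:
  assumes "valid s ((i, b) # w)"
  obtains A l r B where "b" "i \<le> s" "valid (Suc s) w" "length A = i" "l \<noteq> \<langle>\<rangle>"
      "build (Suc j) w = A @ l # r # B" "build j ((i, b) # w) = A @ \<langle>l, Suc j, r\<rangle> # B"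
    | A B where "\<not> b" "i < s" "valid (s - 1) w" "length A = i" "B \<noteq> []"
      "build (Suc j) w = A @ B" "build j ((i, b) # w) = A @ \<langle>\<langle>\<rangle>, Suc j, \<langle>\<rangle>\<rangle> # B"
  using build_cases[of s i b w j thesis] assms build_forests by blast

lemma build_label:
  assumes "valid s w" "t \<in> set (build j w)" "a \<in> set_tree t"
  shows "j < a" "a \<le> j + length w"
  using forests_labels[OF build_forests[OF assms(1)] assms(2,3)] by auto

text \<open>The first letter can be read off the forest: its slot is where the smallest label
  occurs, and its kind tells whether that entry is a single node. Injectivity of
  \<open>build\<close> rests on this.\<close>

lemma build_position:
  assumes "valid s ((i, b) # w)"
  shows "p \<le> s \<Longrightarrow> Suc j \<in> set_tree (build j ((i, b) # w) ! p) \<longleftrightarrow> p = i"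
    and "b \<longleftrightarrow> build j ((i, b) # w) ! i \<noteq> \<langle>\<langle>\<rangle>, Suc j, \<langle>\<rangle>\<rangle>"
proof -
  have n: "Suc j \<notin> set_tree t" if "t \<in> set (build (Suc j) w)" "valid s' w" for t s'
    using build_label[OF that(2,1)] by blast
  have len: "length (build j ((i, b) # w)) = Suc s"
    using build_forests[OF assms, of j] by (simp add: forests_def)
  have "(p \<le> s \<longrightarrow> (Suc j \<in> set_tree (build j ((i, b) # w) ! p) \<longleftrightarrow> p = i)) \<and>
     (b \<longleftrightarrow> build j ((i, b) # w) ! i \<noteq> \<langle>\<langle>\<rangle>, Suc j, \<langle>\<rangle>\<rangle>)"
    using assms
  proof (cases rule: build_Cons_cases[where j = j])
    case (internal A l r B)
    then have "Suc j \<notin> set_tree t" if "t \<in> set A \<union> set B" for t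
      using n[of t] that by auto
    then show ?thesis
      using internal len unfolding internal(7) by (auto simp: nth_append nth_Cons' dest: nth_mem)
  next
    case (leaf A B)
    then have "Suc j \<notin> set_tree t" if "t \<in> set A \<union> set B" for t
      using n[of t] that by auto
    then show ?thesis
      using leaf len unfolding leaf(7) by (auto simp: nth_append nth_Cons' dest: nth_mem)
  qed
  then show "p \<le> s \<Longrightarrow> Suc j \<in> set_tree (build j ((i, b) # w) ! p) \<longleftrightarrow> p = i"
    and "b \<longleftrightarrow> build j ((i, b) # w) ! i \<noteq> \<langle>\<langle>\<rangle>, Suc j, \<langle>\<rangle>\<rangle>" by blast+
qed

lemma build_inj:
  "valid s w \<Longrightarrow> valid s w' \<Longrightarrow> length w = length w' \<Longrightarrow> build j w = build j w' \<Longrightarrow> w = w'"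
proof (induction w arbitrary: j s w')
  case (Cons x v)
  obtain i b where x: "x = (i, b)" by force
  obtain i' b' v' where w': "w' = (i', b') # v'" using Cons.prems by (cases w') auto
  note val = Cons.prems(1)[unfolded x] and val' = Cons.prems(2)[unfolded w']
  have eq: "build j ((i, b) # v) = build j ((i', b') # v')" using Cons.prems x w' by simp
  have le: "i \<le> s" using val by (auto split: if_splits)
  have i: "i' = i"
    using build_position(1)[OF val le, of j] build_position(1)[OF val' le, of j] unfolding eq by (simp del: build.simps)
  have b: "b' = b"
    using build_position(2)[OF val, of j] build_position(2)[OF val', of j] unfolding eq i by (simp del: build.simps)
  from val have "build (Suc j) v = build (Suc j) v' \<and> (\<exists>s. valid s v \<and> valid s v')"
  proof (cases rule: build_Cons_cases[where j = j])
    case outer: (internal A l r B)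
    from val' show ?thesis
    proof (cases rule: build_Cons_cases[where j = j])
      case inner: (internal A' l' r' B')
      have "A @ \<langle>l, Suc j, r\<rangle> # B = A' @ \<langle>l', Suc j, r'\<rangle> # B'"
        using eq unfolding outer(7) inner(7) .
      then have "A = A' \<and> l = l' \<and> r = r' \<and> B = B'"
        using outer(4) inner(4) i by simp
      then show ?thesis
        unfolding outer(6) inner(6) using outer(3) inner(3) by blast
    qed (use b outer(1) in simp)
  next
    case outer: (leaf A B)
    from val' show ?thesis
    proof (cases rule: build_Cons_cases[where j = j])
      case inner: (leaf A' B')
      have "A @ \<langle>\<langle>\<rangle>, Suc j, \<langle>\<rangle>\<rangle> # B = A' @ \<langle>\<langle>\<rangle>, Suc j, \<langle>\<rangle>\<rangle> # B'"
        using eq unfolding outer(7) inner(7) .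
      then have "A = A' \<and> B = B'"
        using outer(4) inner(4) i by simp
      then show ?thesis
        unfolding outer(6) inner(6) using outer(3) inner(3) by blast
    qed (use b outer(1) in simp)
  qed
  then have "v = v'" using Cons.IH Cons.prems(3) w' by auto
  with x w' i b show ?case by simp
qed simp

text \<open>By the heap condition the smallest label is the root of its entry. Removing it undoes a
  first letter, a leaf or an internal one according to whether its left subtree is empty.\<close>

lemma build_surj:
  "F \<in> forests j n s \<Longrightarrow> \<exists>w. length w = n \<and> valid s w \<and> build j w = F"
proof (induction n arbitrary: F j s)
  case 0
  then have len: "length F = Suc s" and shape: "forest_shape F" and lab: "labels F = []"
    by (auto simp: forests_def)
  from lab have L: "t = \<langle>\<rangle>" if "t \<in> set F" for t
    using that by (cases t) auto
  have "butlast F = []"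
  proof (rule ccontr)
    assume "butlast F \<noteq> []"
    then obtain t where "t \<in> set (butlast F)" by (cases "butlast F") auto
    moreover from this have "t = \<langle>\<rangle>" by (rule L[OF in_set_butlastD])
    ultimately show False using shape by (auto simp: forest_shape_def)
  qed
  with len have "s = 0" by (metis diff_Suc_1 length_butlast list.size(3))
  with len obtain t where "F = [t]" by (auto simp: length_Suc_conv)
  with L[of t] have "F = [\<langle>\<rangle>]" by simp
  with \<open>s = 0\<close> show ?case by (intro exI[of _ "[]"]) simp
next
  case (Suc n)
  have "mset (labels F) = mset [Suc j..<Suc (j + Suc n)]" and hp: "\<And>t. t \<in> set F \<Longrightarrow> heap t"
    and len: "length F = Suc s" and shape: "forest_shape F"
    using Suc.prems by (auto simp: forests_def)
  from mset_eq_setD[OF this(1)] have "Suc j \<in> set (labels F)"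
    by (simp del: upt_Suc)
  then obtain t where t: "t \<in> set F" "Suc j \<in> set_tree t" by auto
  then obtain A B where F: "F = A @ t # B" by (meson split_list)
  obtain l a r where node: "t = \<langle>l, a, r\<rangle>" using t(2) by (cases t) auto
  have "a \<le> Suc j" using heap_root[of l a r] hp[OF t(1)] t(2) unfolding node by blast
  moreover have "j < a" using forests_labels(1)[OF Suc.prems t(1), of a] node by simp
  ultimately have a: "a = Suc j" by simp
  show ?case
  proof (cases "l = \<langle>\<rangle>")
    case True
    have "r = \<langle>\<rangle>"
    proof (cases "B = []")
      case True
      with shape F node \<open>l = \<langle>\<rangle>\<close> show ?thesis by (simp add: forest_shape_def)
    next
      case False
      with shape F have "full_tree t" by (simp add: forest_shape_def butlast_append)
      with node \<open>l = \<langle>\<rangle>\<close> show ?thesis by simp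
    qed
    with True F node a have F': "F = A @ \<langle>\<langle>\<rangle>, Suc j, \<langle>\<rangle>\<rangle> # B" by simp
    with Suc.prems have "0 < s" "B \<noteq> []" "A @ B \<in> forests (Suc j) n (s - 1)"
      by (simp_all add: forests_leaf)
    with Suc.IH obtain w where w: "length w = n" "valid (s - 1) w" "build (Suc j) w = A @ B" by blast
    have "length A < s" using len F' \<open>B \<noteq> []\<close> by (cases B) auto
    with w build_leaf[OF w(3) refl] F' show ?thesis
      by (intro exI[of _ "(length A, False) # w"]) (simp del: build.simps)
  next
    case False
    with Suc.prems F node a have "A @ l # r # B \<in> forests (Suc j) n (Suc s)"
      by (simp add: forests_internal)
    with Suc.IH obtain w where w: "length w = n" "valid (Suc s) w" "build (Suc j) w = A @ l # r # B" by blast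
    have "length A \<le> s" using len F by simp
    with w build_internal[OF w(3) refl] F node a show ?thesis
      by (intro exI[of _ "(length A, True) # w"]) (simp del: build.simps)
  qed
qed

section \<open>Reading the conditions on words off the forest\<close>

lemma filled_last_iff:
  "valid s w \<Longrightarrow> p \<le> s \<Longrightarrow> filled_last p w \<longleftrightarrow> j + length w \<in> root_labels (build j w ! p)"
proof (induction w arbitrary: j s p)
  case (Cons x w)
  obtain i b where x: "x = (i, b)" by force
  note val = Cons.prems(1)[unfolded x]
  have len: "length (build j ((i, b) # w)) = Suc s"
    using build_forests[OF val, of j] by (simp add: forests_def)
  show ?case
  proof (cases "w = []")
    case True
    with val have "\<not> b" "i = 0" "s = 1" by (auto split: if_splits)
    with True x Cons.prems show ?thesis by (cases p) auto
  next
    case False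
    from val show ?thesis
    proof (cases rule: build_Cons_cases[where j = j])
      case (internal A l r B)
      have "p < length A \<or> p = length A \<or> p > length A" by linarith
      then have "j + length (x # w) \<in> root_labels (build j (x # w) ! p) \<longleftrightarrow>
          i \<noteq> p \<and> Suc j + length w \<in> root_labels (build (Suc j) w ! shift i b p)"
        unfolding x internal(6,7) using internal(1,4) False
        by (auto simp: nth_append shift_def nth_Cons' Suc_diff_le)
      moreover have "shift i b p \<le> Suc s"
        using Cons.prems internal(1) by (simp add: shift_def)
      ultimately show ?thesis
        using Cons.IH[OF internal(3), of "shift i b p" "Suc j"] False x by simp
    next
      case (leaf A B)
      have "p < length A \<or> p = length A \<or> p > length A" by linarith
      then have "j + length (x # w) \<in> root_labels (build j (x # w) ! p) \<longleftrightarrow>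
          i \<noteq> p \<and> Suc j + length w \<in> root_labels (build (Suc j) w ! shift i b p)"
        unfolding x leaf(6,7) using leaf(1,4) False
        by (auto simp: nth_append shift_def nth_Cons' Suc_diff_le)
      moreover have "i \<noteq> p \<Longrightarrow> shift i b p \<le> s - 1"
        using Cons.prems leaf by (auto simp: shift_def)
      ultimately show ?thesis
        using Cons.IH[OF leaf(3), of "shift i b p" "Suc j"] False x by auto
    qed
  qed
qed simp

text \<open>The letter at position \<open>d\<close> carries label \<open>Suc (j + d)\<close>, and
  the children of \<open>Suc j\<close> are the roots of the entries \<open>i\<close> and
  \<open>i + 1\<close> of the later forest.\<close>

lemma parent_last_iff:
  "valid s w \<Longrightarrow> parent_last d w \<longleftrightarrow> (\<exists>t\<in>set (build j w). j + length w \<in> children t (Suc (j + d)))"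
proof (induction w arbitrary: j s d)
  case (Cons x w)
  obtain i b where x: "x = (i, b)" by force
  note val = Cons.prems(1)[unfolded x]
  have nc: "children t (Suc j) = {}" if "t \<in> set (build (Suc j) w)" "valid s' w" for t s'
    using build_label[OF that(2,1)] by (intro children_eq_empty) blast
  from val show ?case
  proof (cases rule: build_Cons_cases[where j = j])
    case (internal A l r B)
    then have nc': "children t (Suc j) = {}" if "t \<in> set A \<union> set B \<union> {l, r}" for t
      using nc[of t] that by auto
    show ?thesis
    proof (cases d)
      case 0
      have "(\<exists>t\<in>set (build j (x # w)). j + length (x # w) \<in> children t (Suc (j + d))) \<longleftrightarrow>
          Suc j + length w \<in> root_labels l \<union> root_labels r"
        unfolding x internal(7) using nc' 0 by auto
      also have "\<dots> \<longleftrightarrow> filled_last i w \<or> filled_last (Suc i) w"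
        using filled_last_iff[OF internal(3), of i "Suc j"] filled_last_iff[OF internal(3), of "Suc i" "Suc j"] internal(2,4)
        unfolding internal(6) by (auto simp: nth_append)
      finally show ?thesis using x 0 internal(1) by simp
    next
      case (Suc d')
      then show ?thesis
        using Cons.IH[OF internal(3), of d' "Suc j"] unfolding x internal(6,7) by auto
    qed
  next
    case (leaf A B)
    then have nc': "children t (Suc j) = {}" if "t \<in> set A \<union> set B" for t
      using nc[of t] that by auto
    show ?thesis
    proof (cases d)
      case 0
      with leaf(1) nc' show ?thesis unfolding x leaf(7) by auto
    next
      case (Suc d')
      then show ?thesis
        using Cons.IH[OF leaf(3), of d' "Suc j"] unfolding x leaf(6,7) by auto
    qed
  qed
qed simp

lemma tree_eoc_in: "full_tree t \<or> spine_tree t \<Longrightarrow> t \<noteq> \<langle>\<rangle> \<Longrightarrow> tree_eoc t \<in> set_tree t"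
  by (induction t rule: tree_eoc.induct) auto

text \<open>Of two neighbouring slots, the one filled first gets the smaller root, and this is where
  the minimal chain continues.\<close>

lemma chain_ends_iff:
  "valid s w \<Longrightarrow> p < s \<Longrightarrow> chain_ends e p w \<longleftrightarrow> pair_eoc (build j w ! p) (build j w ! Suc p) = Suc (j + e)"
proof (induction w arbitrary: j s p e)
  case (Cons x w)
  obtain i b where x: "x = (i, b)" by force
  note val = Cons.prems(1)[unfolded x]
  let ?F = "build j ((i, b) # w)" and ?G = "build (Suc j) w"
  \<comment> \<open>The later forest contains only labels above \<open>Suc j\<close>; this settles
    \<open>e = 0\<close> whenever the chain survives the first letter.\<close>
  have gt: "Suc j < pair_eoc (?G ! q) (?G ! Suc q)" if v: "valid s' w" and q: "q < s'" for q s'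
  proof -
    have G: "?G \<in> forests (Suc j) (length w) s'" using build_forests[OF v] .
    have full: "full_tree (?G ! q)" using forests_full[OF G q] .
    have "full_tree (?G ! Suc q) \<or> spine_tree (?G ! Suc q)"
    proof (cases "Suc q < s'")
      case True
      then show ?thesis using forests_full[OF G] by blast
    next
      case False
      then have "Suc q = s'" using q by simp
      moreover have "length ?G = Suc s'" using G by (simp add: forests_def)
      then have "last ?G = ?G ! s'" by (subst last_conv_nth) auto
      ultimately have "?G ! Suc q = last ?G" by simp
      then show ?thesis using G by (simp add: forests_def forest_shape_def)
    qed
    then have "pair_eoc (?G ! q) (?G ! Suc q) \<in> set_tree (?G ! q) \<union> set_tree (?G ! Suc q)"
      using full full_tree_not_Leaf[OF full] tree_eoc_in[of "?G ! q"] tree_eoc_in[of "?G ! Suc q"] by auto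
    moreover have "?G ! q \<in> set ?G" "?G ! Suc q \<in> set ?G"
      using G q by (auto simp: forests_def)
    ultimately show ?thesis using build_label(1)[OF v] by blast
  qed
  have root_gt: "Suc j < value t" if "t \<in> set ?G" "valid s' w" "t \<noteq> \<langle>\<rangle>" for t s'
    using build_label(1)[OF that(2,1), of "value t"] that(3) by (cases t) auto
  have shifted: ?case
    if ne: "i \<noteq> p" "i \<noteq> Suc p"
      and v: "valid s' w" and q: "shift i b p < s'"
      and eq: "?F ! p = ?G ! shift i b p" "?F ! Suc p = ?G ! Suc (shift i b p)" for s'
  proof (cases e)
    case 0
    with gt[OF v q] ne show ?thesis unfolding x eq by (simp del: build.simps)
  next
    case (Suc e')
    then show ?thesis
      using Cons.IH[OF v q, of e' "Suc j"] ne unfolding x eq by (simp del: build.simps)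
  qed
  from val show ?case
  proof (cases rule: build_Cons_cases[where j = j])
    case (internal A l r B)
    have l: "l \<in> set ?G" "?G ! i = l" "?G ! Suc i = r"
      unfolding internal(6) using internal(4) by (auto simp: nth_append)
    have new: ?thesis if "pair_eoc (?F ! p) (?F ! Suc p) = pair_eoc l r" "i = p \<or> i = Suc p"
    proof (cases e)
      case 0
      with gt[OF internal(3), of i] internal(1,2) that show ?thesis
        unfolding x l by (simp del: build.simps)
    next
      case (Suc e')
      then show ?thesis
        using Cons.IH[OF internal(3), of i e' "Suc j"] that internal(1,2) unfolding x l by (simp del: build.simps)
    qed
    consider "i = p" | "i = Suc p" | "i \<noteq> p" "i \<noteq> Suc p" by blast
    then show ?thesis
    proof cases
      case 1
      have "?F ! Suc p = ?G ! Suc (Suc p)" "?F ! p = \<langle>l, Suc j, r\<rangle>"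
        unfolding internal(6,7) using internal(4) 1 by (auto simp: nth_append)
      moreover have "?G ! Suc (Suc p) \<in> set ?G"
        using build_forests[OF internal(3), of "Suc j"] Cons.prems(2) by (auto simp: forests_def)
      then have "?G ! Suc (Suc p) = \<langle>\<rangle> \<or> Suc j < value (?G ! Suc (Suc p))"
        using root_gt[OF _ internal(3)] by blast
      ultimately show ?thesis using new internal(5) 1 by auto
    next
      case 2
      have "?F ! p = ?G ! p" "?F ! Suc p = \<langle>l, Suc j, r\<rangle>"
        unfolding internal(6,7) using internal(4) 2 by (auto simp: nth_append)
      moreover have "?G ! p \<in> set ?G" "?G ! p \<noteq> \<langle>\<rangle>"
        using build_forests[OF internal(3), of "Suc j"] forests_full[OF build_forests[OF internal(3), of "Suc j"], of p] Cons.prems(2)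
        by (auto simp: forests_def)
      then have "Suc j < value (?G ! p)"
        using root_gt[OF _ internal(3)] by blast
      ultimately show ?thesis using new internal(5) 2 by auto
    next
      case 3
      show ?thesis
      proof (rule shifted[OF 3 internal(3)])
        show "shift i b p < Suc s" using Cons.prems(2) internal(1) by (simp add: shift_def)
        show "?F ! p = ?G ! shift i b p" "?F ! Suc p = ?G ! Suc (shift i b p)"
          unfolding internal(6,7) using internal(1,4) 3
          by (auto simp: nth_append nth_Cons' shift_def Suc_diff_le)
      qed
    qed
  next
    case (leaf A B)
    have ends: ?thesis if "pair_eoc (?F ! p) (?F ! Suc p) = Suc j" "i = p \<or> i = Suc p"
      using that leaf(1) unfolding x by (cases e) (simp_all del: build.simps)
    consider "i = p" | "i = Suc p" | "i \<noteq> p" "i \<noteq> Suc p" by blast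
    then show ?thesis
    proof cases
      case 1
      have "?F ! Suc p = ?G ! p" "?F ! p = \<langle>\<langle>\<rangle>, Suc j, \<langle>\<rangle>\<rangle>"
        unfolding leaf(6,7) using leaf(4) 1 by (auto simp: nth_append)
      moreover have "?G ! p \<in> set ?G"
        using build_forests[OF leaf(3), of "Suc j"] Cons.prems(2) by (auto simp: forests_def)
      then have "?G ! p = \<langle>\<rangle> \<or> Suc j < value (?G ! p)"
        using root_gt[OF _ leaf(3)] by blast
      ultimately show ?thesis using ends 1 by auto
    next
      case 2
      \<comment> \<open>The leaf lies in the ordinary slot \<open>p + 1\<close>, so slot
        \<open>p\<close> stays ordinary. Its entry is then nonempty and has a root to compare with
        \<open>Suc j\<close>.\<close>
      have "p < s - 1" using leaf(2) 2 by simp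
      have "?F ! p = ?G ! p" "?F ! Suc p = \<langle>\<langle>\<rangle>, Suc j, \<langle>\<rangle>\<rangle>"
        unfolding leaf(6,7) using leaf(4) 2 by (auto simp: nth_append)
      moreover have "?G ! p \<in> set ?G" "?G ! p \<noteq> \<langle>\<rangle>"
        using build_forests[OF leaf(3), of "Suc j"] \<open>p < s - 1\<close> full_tree_not_Leaf[OF forests_full[OF build_forests[OF leaf(3)] \<open>p < s - 1\<close>]]
        by (simp_all add: forests_def)
      then have "Suc j < value (?G ! p)"
        using root_gt[OF _ leaf(3)] by blast
      ultimately show ?thesis using ends 2 by auto
    next
      case 3
      show ?thesis
      proof (rule shifted[OF 3 leaf(3)])
        show "shift i b p < s - 1" using Cons.prems(2) 3 leaf(1,2) by (auto simp: shift_def)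
        show "?F ! p = ?G ! shift i b p" "?F ! Suc p = ?G ! Suc (shift i b p)"
          unfolding leaf(6,7) using leaf(1,4) 3
          by (auto simp: nth_append nth_Cons' shift_def Suc_diff_le)
      qed
    qed
  qed
qed simp

lemma f2_eq_word_count:
  assumes "n \<ge> 1" "m \<in> {2..2 * n}" "k \<in> {1..2 * n - 1}"
  shows "f2 n m k = word_count n m k"
proof -
  let ?W = "{w. length w = 2 * n - 1 \<and> valid 1 w \<and> chain_ends (m - 2) 0 w \<and> parent_last (k - 1) ((0, True) # w)}"
  let ?T = "{t \<in> complete_increasing_trees (2 * n). eoc t = m \<and> pom t = k}"
  let ?h = "\<lambda>w. hd (build 0 ((0, True) # w))"
  \<comment> \<open>Without ordinary slots a forest is the single spine tree in the special
    slot.\<close>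
  have mem: "t \<in> complete_increasing_trees (2 * n) \<longleftrightarrow> [t] \<in> forests 0 (2 * n) 0" for t
    unfolding complete_increasing_trees_iff[OF assms(1)] by (auto simp: forests_def forest_shape_def)
  have h: "build 0 ((0, True) # w) = [?h w] \<and> ?h w \<in> complete_increasing_trees (2 * n) \<and>
      (eoc (?h w) = m \<longleftrightarrow> chain_ends (m - 2) 0 w) \<and> (pom (?h w) = k \<longleftrightarrow> parent_last (k - 1) ((0, True) # w))"
    if w: "length w = 2 * n - 1" "valid 1 w" for w
  proof -
    let ?x = "(0, True) # w"
    have x: "valid 0 ?x" "length ?x = 2 * n" using w assms(1) by auto
    have "length (build 1 w) = 2" using build_forests[OF w(2), of 1] by (simp add: forests_def)
    then obtain l r where lr: "build 1 w = [l, r]" by (auto simp: length_Suc_conv numeral_2_eq_2)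
    define t where "t = \<langle>l, 1, r\<rangle>"
    have bx: "build 0 ?x = [t]" using lr by (simp add: t_def)
    have "full_tree l" using forests_full[OF build_forests[OF w(2), of 1], of 0] lr by simp
    then have l: "l \<noteq> \<langle>\<rangle>" by auto
    have T: "t \<in> complete_increasing_trees (2 * n)"
      unfolding mem bx[symmetric] using build_forests[OF x(1), of 0] x(2) by simp
    then have tree: "spine_tree (t)" "mset (inorder (t)) = mset [1..<Suc (2 * n)]"
      unfolding complete_increasing_trees_iff[OF assms(1)] by simp_all
    have distinct: "distinct (inorder (t))"
      using mset_eq_imp_distinct_iff[OF tree(2)] by simp
    have size: "size (t) = 2 * n"
      using mset_eq_length[OF tree(2)] by (simp del: upt_Suc build.simps)
    have set: "set_tree (t) = {1..2 * n}"
      using mset_eq_setD[OF tree(2)] by (simp add: atLeastLessThanSuc_atLeastAtMost del: upt_Suc build.simps)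
    have "eoc (t) = pair_eoc l r"
      using eoc_eq_tree_eoc[OF distinct tree(1)] l unfolding t_def by simp
    \<comment> \<open>The word \<open>w\<close> starts with label 2, so the label \<open>m\<close>
      is at position \<open>m - 2\<close>.\<close>
    moreover have "Suc (1 + (m - 2)) = m" using assms(2) by auto
    ultimately have eoc: "eoc (t) = m \<longleftrightarrow> chain_ends (m - 2) 0 w"
      using chain_ends_iff[OF w(2), of 0 "m - 2" 1] unfolding lr by simp
    have "size (t) \<in> set_tree (t)" "size (t) \<notin> root_labels (t)"
      unfolding size set using assms(1) t_def by simp_all
    from pom_eq_iff[OF distinct this] have "pom (t) = k \<longleftrightarrow> 2 * n \<in> children (t) k"
      unfolding size .
    also have "\<dots> \<longleftrightarrow> parent_last (k - 1) ?x"
      using parent_last_iff[OF x(1), of "k - 1" 0] assms(3) unfolding bx x(2) by simp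
    finally show ?thesis using T eoc unfolding bx by simp
  qed
  have "bij_betw ?h ?W ?T"
  proof (rule bij_betw_imageI)
    show "inj_on ?h ?W"
    proof (rule inj_onI)
      fix v w assume v: "v \<in> ?W" and w: "w \<in> ?W" and eq: "?h v = ?h w"
      have "build 0 ((0, True) # v) = [?h v]" using h v by blast
      also have "\<dots> = build 0 ((0, True) # w)" using h[of w] w eq by auto
      finally have "(0, True) # v = (0, True) # w"
        by (intro build_inj[where s = 0 and j = 0]) (use v w in auto)
      then show "v = w" by simp
    qed
    show "?h ` ?W = ?T"
    proof
      show "?h ` ?W \<subseteq> ?T" using h by blast
      show "?T \<subseteq> ?h ` ?W"
      proof
        fix t assume t: "t \<in> ?T"
        then have "[t] \<in> forests 0 (2 * n) 0" using mem by blast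
        then obtain x where x: "length x = 2 * n" "valid 0 x" "build 0 x = [t]"
          using build_surj by blast
        obtain i b w where ibw: "x = (i, b) # w" using x(1) assms(1) by (cases x) auto
        \<comment> \<open>Over no ordinary slots the only possible first letter is an internal node
          in the special slot, which has number 0.\<close>
        with x have "x = (0, True) # w" "valid 1 w" "length w = 2 * n - 1"
          by (auto split: if_splits)
        moreover from this x(3) have "?h w = t" by simp
        ultimately have "w \<in> ?W" using h[of w] t by blast
        with \<open>?h w = t\<close> show "t \<in> ?h ` ?W" by blast
      qed
    qed
  qed
  then have "card ?W = card ?T" by (rule bij_betw_same_card)
  then show ?thesis
    using assms by (simp add: f2_def word_count_def count_def)
qed

theorem theorem1p6:
  fixes n m k :: nat
  assumes "n \<ge> 1"
    and "(m, k) \<in> Up n"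
  shows "f2 n (2*n + 1 - k) (2*n + 1 - m) = f2 n m k"
proof -
  have "m \<in> {2..2 * n}" "k \<in> {1..2 * n - 1}"
    using assms(2) by (auto simp: Up_def)
  moreover from this have "2 * n + 1 - k \<in> {2..2 * n}" "2 * n + 1 - m \<in> {1..2 * n - 1}"
    by auto
  ultimately show ?thesis
    using word_count_sym[OF assms] by (simp only: f2_eq_word_count[OF assms(1)])
qed

end
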